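(* Let $\tilde W_S>0$, $L/\xi\ge1$, $\kappa\in(0,1)$. If $\tilde E_B=0$ and $\tilde W_S^2<\frac{2}{1+\kappa}$, and $\theta$ is a nontrivial (nonconstant) solution of the boundary value problem (BVP) given in the context, then $\mathrm{Hess}_\theta(\varphi,\varphi)\ge0$ for every $\varphi\in W^{1,2}_0(0,1)$.
   Context: Parameters: $\tilde W_S$ (surface anchoring strength), $\tilde E_B$ (bias field), $L/\xi$ (ratio of cell thickness to correlation length), $\kappa$ (bend-to-splay ratio). (BVP): the Euler-Lagrange equation $$(\sin^2\theta+\kappa\cos^2\theta)\theta''+\tfrac12(1-\kappa)\sin 2\theta\,(\theta')^2+\tfrac12\left(\tfrac{L}{\xi}\right)^2\sin2\theta-\tilde E_B\left(\tfrac L\xi\right)^2\sin\theta=0\quad\text{on }(0,1)$$ with the nonlinear boundary conditions $$-\tilde W_S\left(\tfrac L\xi\right)\sin\theta+(\sin^2\theta+\kappa\cos^2\theta)\theta'=0\quad\text{at }x=0\text{ and }x=1.$$ A solution is a (smooth) function $\theta:[0,1]\to[0,\pi]$ satisfying the equation and both boundary conditions. Energy: $$I(\theta)=\frac12\int_0^1(\sin^2\theta+\kappa\cos^2\theta)(\theta')^2dx+\frac12\left(\frac L\xi\right)^2\int_0^1(\cos^2\theta-2\tilde E_B\cos\theta)dx-\tilde W_S\frac L\xi\cos\theta(0)+\tilde W_S\frac L\xi\cos\theta(1).$$ Second variation: $\mathrm{Hess}_\theta(\varphi,\varphi)=\frac{d^2}{d\varepsilon^2}I(\theta+\varepsilon\varphi)\big|_{\varepsilon=0}$.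 *)

theory Defs
  imports "HOL-Analysis.Analysis"
begin

section \<open>Sobolev spaces on the unit interval\<close>

text \<open>
  Elements of the function spaces below are represented by functions on the real line of which only
  the values almost everywhere in the open unit interval matter.
\<close>

abbreviation unit_measure :: "real measure" where
  "unit_measure \<equiv> lebesgue_on {0<..<1}"

text \<open>Derivatives are taken relative to \<open>S\<close>, so they are one-sided at endpoints of an interval.\<close>

definition smooth_on :: "real set \<Rightarrow> (real \<Rightarrow> real) \<Rightarrow> bool" where
  "smooth_on S f \<longleftrightarrow>
     (\<exists>D :: nat \<Rightarrow> real \<Rightarrow> real.
        (\<forall>x\<in>S. D 0 x = f x) \<and>
        (\<forall>n. \<forall>x\<in>S. (D n has_real_derivative D (Suc n) x) (at x within S)))"

definition test_functions :: "(real \<Rightarrow> real) set" where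
  "test_functions =
     {\<eta>. smooth_on UNIV \<eta> \<and> compact (closure {x. \<eta> x \<noteq> 0}) \<and> closure {x. \<eta> x \<noteq> 0} \<subseteq> {0<..<1}}"

definition L2 :: "(real \<Rightarrow> real) set" where
  "L2 = {f \<in> borel_measurable unit_measure. integrable unit_measure (\<lambda>x. (f x)\<^sup>2)}"

definition has_weak_deriv :: "(real \<Rightarrow> real) \<Rightarrow> (real \<Rightarrow> real) \<Rightarrow> bool" where
  "has_weak_deriv u g \<longleftrightarrow>
     (\<forall>\<eta>\<in>test_functions.
        (LINT x|unit_measure. u x * deriv \<eta> x) = - (LINT x|unit_measure. g x * \<eta> x))"

definition W12 :: "(real \<Rightarrow> real) set" where
  "W12 = {u \<in> L2. \<exists>g\<in>L2. has_weak_deriv u g}"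

text \<open>The weak derivative of an element of \<open>W12\<close>; it is unique up to null sets.\<close>

definition weak_deriv :: "(real \<Rightarrow> real) \<Rightarrow> real \<Rightarrow> real" where
  "weak_deriv u = (SOME g. g \<in> L2 \<and> has_weak_deriv u g)"

definition W12_norm :: "(real \<Rightarrow> real) \<Rightarrow> real" where
  "W12_norm u =
     sqrt ((LINT x|unit_measure. (u x)\<^sup>2) + (LINT x|unit_measure. (weak_deriv u x)\<^sup>2))"

definition W12_0 :: "(real \<Rightarrow> real) set" where
  "W12_0 = {u \<in> W12. \<exists>\<eta> :: nat \<Rightarrow> real \<Rightarrow> real.
     (\<forall>n. \<eta> n \<in> test_functions) \<and> (\<lambda>n. W12_norm (\<lambda>x. u x - \<eta> n x)) \<longlonglongrightarrow> 0}"

text \<open>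
  Boundary values of an element of \<open>W12\<close> are those of its continuous representative, which on
  the closed unit interval is unique.
\<close>

definition cont_rep :: "(real \<Rightarrow> real) \<Rightarrow> real \<Rightarrow> real" where
  "cont_rep u = (SOME v. continuous_on {0..1} v \<and> (AE x in unit_measure. v x = u x))"


section \<open>The boundary value problem, its energy and the second variation\<close>

text \<open>
  Throughout, \<open>W\<close> is the surface anchoring strength, \<open>E\<close> the bias field, \<open>l\<close> the ratio of cell
  thickness to correlation length, and \<open>\<kappa>\<close> the bend-to-splay ratio.
\<close>

definition elastic :: "real \<Rightarrow> real \<Rightarrow> real" where
  "elastic \<kappa> t = (sin t)\<^sup>2 + \<kappa> * (cos t)\<^sup>2"

abbreviation unit_deriv :: "(real \<Rightarrow> real) \<Rightarrow> real \<Rightarrow> real" where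
  "unit_deriv f \<equiv> \<lambda>x. vector_derivative f (at x within {0..1})"

definition bvp_solution :: "real \<Rightarrow> real \<Rightarrow> real \<Rightarrow> real \<Rightarrow> (real \<Rightarrow> real) \<Rightarrow> bool" where
  "bvp_solution W E l \<kappa> \<theta> \<longleftrightarrow>
     smooth_on {0..1} \<theta> \<and> \<theta> \<in> {0..1} \<rightarrow> {0..pi} \<and>
     (\<forall>x\<in>{0<..<1}.
        elastic \<kappa> (\<theta> x) * unit_deriv (unit_deriv \<theta>) x
        + 1/2 * (1 - \<kappa>) * sin (2 * \<theta> x) * (unit_deriv \<theta> x)\<^sup>2
        + 1/2 * l\<^sup>2 * sin (2 * \<theta> x)
        - E * l\<^sup>2 * sin (\<theta> x) = 0) \<and>
     (\<forall>x\<in>{0, 1}. - W * l * sin (\<theta> x) + elastic \<kappa> (\<theta> x) * unit_deriv \<theta> x = 0)"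

definition energy :: "real \<Rightarrow> real \<Rightarrow> real \<Rightarrow> real \<Rightarrow> (real \<Rightarrow> real) \<Rightarrow> real" where
  "energy W E l \<kappa> u =
     1/2 * (LINT x|unit_measure. elastic \<kappa> (u x) * (weak_deriv u x)\<^sup>2)
     + 1/2 * l\<^sup>2 * (LINT x|unit_measure. (cos (u x))\<^sup>2 - 2 * E * cos (u x))
     - W * l * cos (cont_rep u 0) + W * l * cos (cont_rep u 1)"

definition hess :: "real \<Rightarrow> real \<Rightarrow> real \<Rightarrow> real \<Rightarrow> (real \<Rightarrow> real) \<Rightarrow> (real \<Rightarrow> real) \<Rightarrow> real" where
  "hess W E l \<kappa> \<theta> \<phi> = deriv (deriv (\<lambda>\<epsilon>. energy W E l \<kappa> (\<lambda>x. \<theta> x + \<epsilon> * \<phi> x))) 0"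

end

theory Submission
  imports Defs "HOL-Real_Asymp.Real_Asymp"
begin

text \<open>
  Without bias field the equation is autonomous, so the derivative \<open>p = \<theta>'\<close> of a solution satisfies the
  linearised equation. The first integral \<open>e(\<theta>) p\<^sup>2 + l\<^sup>2 sin\<^sup>2 \<theta>\<close>, with
  \<open>e(\<theta>) = sin\<^sup>2 \<theta> + \<kappa> cos\<^sup>2 \<theta>\<close>, together with the boundary conditions forces
  \<open>sin \<theta>(0) = sin \<theta>(1)\<close> and hence \<open>p(0) = p(1)\<close>. If \<open>p\<close> vanished somewhere, then either
  \<open>\<theta>\<close> would coincide with the equilibrium \<open>\<pi>/2\<close>, or \<open>\<theta>\<close> would stay on one side of \<open>\<pi>/2\<close>,
  where \<open>\<surd>e(\<theta>) p\<close> is monotone; both are impossible. So \<open>p\<close> is a positive solution of the linearised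
  equation, and completing the square (Jacobi) gives
  \<open>Hess(\<eta>, \<eta>) = \<integral> e(\<theta>) (\<eta>' - (p'/p) \<eta>)\<^sup>2 \<ge> 0\<close> for test functions \<open>\<eta>\<close>; the general case follows by density.
\<close>

section \<open>Smooth functions with compact support\<close>

text \<open>Why the ends match: eliminating p by the boundary condition turns the first integral
  into l^2 s (W^2 / e + 1) with s = sin^2 theta and e = kappa + (1 - kappa) s. This is strictly
  increasing in s, and both ends share its value. Why p has no zero: a zero puts the first integral
  at or below l^2, its value at the saddle pi/2. Equality is excluded by a Gronwall estimate, and a
  smaller value keeps cos theta away from 0. The analytic obstacle is that the energy is built from
  arbitrary choices (\<open>weak_deriv\<close>, \<open>cont_rep\<close>) and that its second
  derivative contains v^2 g^2 with g merely square integrable. A continuous representative v of phi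
  that vanishes at both ends settles this: it is bounded, so two derivatives pass under the
  integral, and it freezes the anchoring terms. Replacing the chosen weak derivative by a convenient
  one needs uniqueness up to null sets, and this is why explicit test functions are
  constructed.\<close>

definition flat :: "real poly \<Rightarrow> real \<Rightarrow> real" where
  "flat p x = (if x > 0 then poly p (inverse x) * exp (- inverse x) else 0)"

lemma poly_times_exp_minus_tendsto_0:
  fixes p :: "real poly"
  shows "((\<lambda>y. poly p y * exp (- y)) \<longlongrightarrow> 0) at_top"
proof -
  have "((\<lambda>y::real. \<Sum>i\<le>degree p. coeff p i * (y ^ i / exp y)) \<longlongrightarrow> (\<Sum>i\<le>degree p. coeff p i * 0)) at_top"
    by (intro tendsto_intros tendsto_power_div_exp_0)
  then show ?thesis
    by (simp add: poly_altdef exp_minus sum_distrib_right divide_inverse mult.assoc)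
qed

text \<open>With y = 1/x one has dy/dx = -y^2, so p(y) exp(-y) has derivative y^2 (p - p')(y)
  exp(-y); \<open>[:0, 0, 1:]\<close> is y^2. Carrying an arbitrary polynomial covers all
  derivatives of exp(-1/x) at once.\<close>

lemma flat_has_derivative:
  "(flat p has_real_derivative flat ([:0, 0, 1:] * (p - pderiv p)) x) (at x)"
proof -
  consider "x > 0" | "x < 0" | "x = 0" by linarith
  then show ?thesis
  proof cases
    case 1
    have "((\<lambda>x. poly p (inverse x) * exp (- inverse x)) has_real_derivative
        flat ([:0, 0, 1:] * (p - pderiv p)) x) (at x)"
      using 1 by (auto intro!: derivative_eq_intros simp: flat_def field_simps power2_eq_square)
    then show ?thesis
      by (rule has_field_derivative_transform_within_open[where S = "{0<..}"]) (use 1 in \<open>auto simp: flat_def\<close>)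
  next
    case 2
    have "((\<lambda>x. 0) has_real_derivative flat ([:0, 0, 1:] * (p - pderiv p)) x) (at x)"
      using 2 by (auto simp: flat_def)
    then show ?thesis
      by (rule has_field_derivative_transform_within_open[where S = "{..<0}"]) (use 2 in \<open>auto simp: flat_def\<close>)
  next
    case 3
    have "((\<lambda>h. flat p h / h) \<longlongrightarrow> 0) (at_right 0)"
    proof -
      \<comment> \<open>The factor \<open>[:0,1:]\<close> absorbs the division by \<open>h\<close>
        in the difference quotient.\<close>
      have "((\<lambda>h. poly ([:0,1:] * p) (inverse h) * exp (- inverse h)) \<longlongrightarrow> 0) (at_right (0::real))"
        by (rule filterlim_compose[OF poly_times_exp_minus_tendsto_0 filterlim_inverse_at_top_right])
      then show ?thesis
        by (rule Lim_transform_eventually)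
          (auto simp: eventually_at_filter flat_def field_simps)
    qed
    moreover have "((\<lambda>h. flat p h / h) \<longlongrightarrow> 0) (at_left 0)"
      by (rule Lim_transform_eventually[OF tendsto_const]) (auto simp: eventually_at_filter flat_def)
    ultimately have "((\<lambda>h. flat p h / h) \<longlongrightarrow> 0) (at 0)"
      using filterlim_split_at by blast
    then show ?thesis
      using 3 by (simp add: DERIV_def flat_def)
  qed
qed

text \<open>\<open>smooth_on\<close> asks for an infinite sequence of successive derivatives. A
  class containing a derivative of each of its members supplies one by iteration, with no formula
  for higher derivatives of products.\<close>

inductive_set bump_algebra :: "(real \<Rightarrow> real) set" where
  flat: "(\<lambda>x. flat p (c * x + d)) \<in> bump_algebra"
| add: "f \<in> bump_algebra \<Longrightarrow> g \<in> bump_algebra \<Longrightarrow> (\<lambda>x. f x + g x) \<in> bump_algebra"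
| mult: "f \<in> bump_algebra \<Longrightarrow> g \<in> bump_algebra \<Longrightarrow> (\<lambda>x. f x * g x) \<in> bump_algebra"

lemma bump_algebra_derivative:
  assumes "f \<in> bump_algebra"
  shows "\<exists>g\<in>bump_algebra. \<forall>x. (f has_real_derivative g x) (at x)"
  using assms
proof induction
  case (flat p c d)
  define q where "q = smult c ([:0, 0, 1:] * (p - pderiv p))"
  have "((\<lambda>x. flat p (c * x + d)) has_real_derivative flat q (c * x + d)) (at x)" for x
  proof -
    have "((\<lambda>x. flat p (c * x + d)) has_real_derivative
        flat ([:0, 0, 1:] * (p - pderiv p)) (c * x + d) * c) (at x)"
      by (rule DERIV_chain2[OF flat_has_derivative]) (auto intro!: derivative_eq_intros)
    moreover have "flat ([:0, 0, 1:] * (p - pderiv p)) (c * x + d) * c = flat q (c * x + d)"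
      by (simp add: q_def flat_def)
    ultimately show ?thesis by simp
  qed
  then show ?case by (intro bexI[of _ "\<lambda>x. flat q (c * x + d)"] bump_algebra.flat) auto
next
  case (add f g)
  then obtain f' g' where "f' \<in> bump_algebra" "g' \<in> bump_algebra"
    "\<And>x. (f has_real_derivative f' x) (at x)" "\<And>x. (g has_real_derivative g' x) (at x)" by blast
  then show ?case
    by (intro bexI[of _ "\<lambda>x. f' x + g' x"]) (auto intro!: derivative_eq_intros bump_algebra.add)
next
  case (mult f g)
  then obtain f' g' where "f' \<in> bump_algebra" "g' \<in> bump_algebra"
    "\<And>x. (f has_real_derivative f' x) (at x)" "\<And>x. (g has_real_derivative g' x) (at x)" by blast
  with mult.hyps show ?case
    by (intro bexI[of _ "\<lambda>x. f' x * g x + f x * g' x"])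
      (auto intro!: derivative_eq_intros bump_algebra.add bump_algebra.mult)
qed

lemma smooth_on_bump_algebra:
  assumes "f \<in> bump_algebra"
  shows "smooth_on S f"
proof -
  obtain d where d: "\<And>f. f \<in> bump_algebra \<Longrightarrow> d f \<in> bump_algebra"
    "\<And>f x. f \<in> bump_algebra \<Longrightarrow> (f has_real_derivative d f x) (at x)"
    using bump_algebra_derivative by metis
  have "(d ^^ n) f \<in> bump_algebra" for n
    by (induction n) (use assms d in auto)
  then show ?thesis
    unfolding smooth_on_def
    by (intro exI[of _ "\<lambda>n. (d ^^ n) f"]) (auto intro: has_field_derivative_at_within d(2))
qed

text \<open>Since \<open>exp (-1 / (n x)) \<longlonglongrightarrow> 1\<close> for \<open>x > 0\<close>, dilated flat functions approximate indicators; the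
  shrinking margin \<open>(b - a) / (n + 3)\<close> keeps the support compact when \<open>a = 0\<close> or \<open>b = 1\<close>.\<close>

definition step :: "real \<Rightarrow> real \<Rightarrow> nat \<Rightarrow> real \<Rightarrow> real" where
  "step a b n x = flat 1 (real n * x + - real n * (a + (b - a) / (n + 3)))
     * flat 1 (- real n * x + real n * (b - (b - a) / (n + 3)))"

lemma abs_flat_1_le: "\<bar>flat 1 x\<bar> \<le> 1"
  by (simp add: flat_def)

lemma abs_step_le: "\<bar>step a b n x\<bar> \<le> 1"
  unfolding step_def abs_mult by (intro mult_le_one abs_flat_1_le) auto

lemma step_support:
  assumes "step a b n x \<noteq> 0"
  shows "x \<in> {a + (b - a) / (n + 3) .. b - (b - a) / (n + 3)}"
proof -
  define \<delta> where "\<delta> = (b - a) / (n + 3)"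
  have "real n * x + - real n * (a + \<delta>) > 0" "- real n * x + real n * (b - \<delta>) > 0"
    using assms by (auto simp: step_def flat_def \<delta>_def split: if_splits)
  then have "real n * (x - (a + \<delta>)) > 0" "real n * ((b - \<delta>) - x) > 0"
    by (simp_all add: algebra_simps)
  then show ?thesis
    unfolding \<delta>_def[symmetric] by (simp add: zero_less_mult_iff)
qed

lemma step_mem_test_functions:
  assumes "0 \<le> a" "a < b" "b \<le> 1"
  shows "step a b n \<in> test_functions"
proof -
  have pos: "(b - a) / (n + 3) > 0" using assms by simp
  have sub: "{x. step a b n x \<noteq> 0} \<subseteq> {a + (b - a) / (n + 3) .. b - (b - a) / (n + 3)}"
    using step_support by auto
  have "closure {x. step a b n x \<noteq> 0} \<subseteq> {a + (b - a) / (n + 3) .. b - (b - a) / (n + 3)}"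
    by (intro closure_minimal sub closed_atLeastAtMost)
  also have "\<dots> \<subseteq> {0<..<1}"
    using assms pos by (intro subsetI) (unfold atLeastAtMost_iff greaterThanLessThan_iff, linarith)
  finally have "closure {x. step a b n x \<noteq> 0} \<subseteq> {0<..<1}" .
  moreover have "bounded {x. step a b n x \<noteq> 0}"
    using bounded_subset[OF bounded_closed_interval sub] by simp
  moreover have "step a b n \<in> bump_algebra"
    unfolding step_def by (intro bump_algebra.intros)
  ultimately show ?thesis
    unfolding test_functions_def by (auto simp: smooth_on_bump_algebra compact_closure)
qed

lemma flat_tendsto_1:
  assumes "filterlim f at_top sequentially"
  shows "(\<lambda>n. flat 1 (f n)) \<longlonglongrightarrow> 1"
proof -
  have "(flat 1 \<longlongrightarrow> 1) at_top"
  proof (rule Lim_transform_eventually)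
    show "((\<lambda>x. exp (- inverse x)) \<longlongrightarrow> (1::real)) at_top" by real_asymp
    show "\<forall>\<^sub>F x in at_top. exp (- inverse x) = flat 1 x"
      using eventually_gt_at_top[of 0] by eventually_elim (simp add: flat_def)
  qed
  then show ?thesis using assms by (rule filterlim_compose)
qed

lemma step_tendsto_indicator:
  assumes "a < b"
  shows "(\<lambda>n. step a b n x) \<longlonglongrightarrow> indicator {a<..<b} x"
proof (cases "x \<in> {a<..<b}")
  case True
  \<comment> \<open>In terms of the distances to the endpoints the margin costs n (u + v) / (n + 3)
    < u + v, so both arguments of \<open>flat 1\<close> still grow linearly in n.\<close>
  define u v where "u = x - a" and "v = b - x"
  have "u > 0" "v > 0" using True by (auto simp: u_def v_def)
  have "filterlim (\<lambda>n. real n * u - real n * (u + v) / (real n + 3)) at_top sequentially"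
    using \<open>u > 0\<close> \<open>v > 0\<close> by real_asymp
  moreover have "filterlim (\<lambda>n. real n * v - real n * (u + v) / (real n + 3)) at_top sequentially"
    using \<open>u > 0\<close> \<open>v > 0\<close> by real_asymp
  moreover have "real n * u - real n * (u + v) / (real n + 3)
      = real n * x + - real n * (a + (b - a) / (n + 3))"
    "real n * v - real n * (u + v) / (real n + 3)
      = - real n * x + real n * (b - (b - a) / (n + 3))" for n
    by (simp_all add: u_def v_def ring_distribs) (simp_all add: field_simps)
  ultimately have "(\<lambda>n. step a b n x) \<longlonglongrightarrow> 1 * 1"
    unfolding step_def by (intro tendsto_mult flat_tendsto_1) simp_all
  then show ?thesis using True by simp
next
  case False
  have "step a b n x = 0" for n
  proof (rule ccontr)
    assume "step a b n x \<noteq> 0"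
    moreover have "(b - a) / (n + 3) > 0" using assms by simp
    ultimately show False
      using step_support[of a b n x] False by auto
  qed
  then show ?thesis using False by simp
qed

section \<open>Sobolev functions on the unit interval\<close>

lemma finite_measure_unit: "finite_measure unit_measure"
  by (rule finite_measure_lebesgue_on) simp

lemma borel_measurable_unit:
  fixes f :: "real \<Rightarrow> real"
  assumes "continuous_on {0..1} f"
  shows "f \<in> borel_measurable unit_measure"
  by (rule continuous_imp_measurable_on_sets_lebesgue)
    (auto intro: continuous_on_subset[OF assms])

lemma bounded_mult_integrable_unit:
  fixes f g :: "real \<Rightarrow> real"
  assumes "integrable unit_measure g" "f \<in> borel_measurable unit_measure"
    and "\<And>x. x \<in> {0..1} \<Longrightarrow> \<bar>f x\<bar> \<le> B"
  shows "integrable unit_measure (\<lambda>x. f x * g x)"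
proof (rule Bochner_Integration.integrable_bound)
  show "integrable unit_measure (\<lambda>x. B * \<bar>g x\<bar>)" using assms(1) by auto
  show "(\<lambda>x. f x * g x) \<in> borel_measurable unit_measure" using assms(1,2) by measurable
  show "AE x in unit_measure. norm (f x * g x) \<le> norm (B * \<bar>g x\<bar>)"
  proof (rule AE_I2)
    fix x assume "x \<in> space unit_measure"
    then have "\<bar>f x\<bar> \<le> B" by (intro assms(3)) auto
    then have "\<bar>f x\<bar> * \<bar>g x\<bar> \<le> \<bar>B\<bar> * \<bar>g x\<bar>" by (intro mult_right_mono) auto
    then show "norm (f x * g x) \<le> norm (B * \<bar>g x\<bar>)" by (simp add: abs_mult)
  qed
qed

lemma continuous_unit_bounded:
  fixes f :: "real \<Rightarrow> real"
  assumes "continuous_on {0..1} f"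
  obtains B where "B > 0" "\<And>x. x \<in> {0..1} \<Longrightarrow> \<bar>f x\<bar> \<le> B"
proof -
  have "bounded (f ` {0..1})"
    using assms compact_continuous_image compact_imp_bounded by blast
  then show ?thesis
    using that by (auto simp: bounded_pos)
qed

lemma const_integrable_unit: "integrable unit_measure (\<lambda>x. c :: real)"
  using finite_measure.integrable_const[OF finite_measure_unit] .

lemma continuous_mult_integrable_unit:
  fixes f g :: "real \<Rightarrow> real"
  assumes "integrable unit_measure g" "continuous_on {0..1} f"
  shows "integrable unit_measure (\<lambda>x. f x * g x)"
  by (rule continuous_unit_bounded[OF assms(2)])
    (rule bounded_mult_integrable_unit[OF assms(1) borel_measurable_unit[OF assms(2)]])

lemma continuous_integrable_unit:
  fixes f :: "real \<Rightarrow> real"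
  assumes "continuous_on {0..1} f"
  shows "integrable unit_measure f"
  using continuous_mult_integrable_unit[OF const_integrable_unit assms, of 1] by simp

lemma continuous_mem_L2: "continuous_on {0..1} f \<Longrightarrow> f \<in> L2"
  unfolding L2_def by (auto intro!: borel_measurable_unit continuous_integrable_unit continuous_intros)

lemma L2_measurable: "f \<in> L2 \<Longrightarrow> f \<in> borel_measurable unit_measure"
  by (simp add: L2_def)

lemma L2_square_integrable: "f \<in> L2 \<Longrightarrow> integrable unit_measure (\<lambda>x. (f x)\<^sup>2)"
  by (simp add: L2_def)

lemma L2_mult_integrable:
  assumes "f \<in> L2" "g \<in> L2"
  shows "integrable unit_measure (\<lambda>x. f x * g x)"
proof (rule Bochner_Integration.integrable_bound)
  show "integrable unit_measure (\<lambda>x. (f x)\<^sup>2 + (g x)\<^sup>2)"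
    using assms by (intro Bochner_Integration.integrable_add L2_square_integrable)
  show "(\<lambda>x. f x * g x) \<in> borel_measurable unit_measure"
    using assms[THEN L2_measurable] by measurable
  have "\<bar>a * b\<bar> \<le> a\<^sup>2 + b\<^sup>2" for a b :: real
    using sum_squares_bound[of "\<bar>a\<bar>" "\<bar>b\<bar>"] mult_nonneg_nonneg[of "\<bar>a\<bar>" "\<bar>b\<bar>"]
    unfolding abs_mult power2_abs by linarith
  then show "AE x in unit_measure. norm (f x * g x) \<le> norm ((f x)\<^sup>2 + (g x)\<^sup>2)"
    by (intro AE_I2) auto
qed

lemma L2_integrable: "f \<in> L2 \<Longrightarrow> integrable unit_measure f"
  using L2_mult_integrable[OF _ continuous_mem_L2, of f "\<lambda>x. 1"] by simp

text \<open>The scalar serves two purposes: \<open>c = -1\<close> gives differences, a general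
  \<open>c\<close> the perturbed field and its derivative.\<close>

lemma L2_add:
  assumes "f \<in> L2" "g \<in> L2"
  shows "(\<lambda>x. f x + c * g x) \<in> L2"
proof -
  have "(\<lambda>x. (f x + c * g x)\<^sup>2) = (\<lambda>x. (f x)\<^sup>2 + 2 * c * (f x * g x) + c\<^sup>2 * (g x)\<^sup>2)"
    by (auto simp: power2_eq_square algebra_simps)
  moreover have "integrable unit_measure (\<lambda>x. (f x)\<^sup>2 + 2 * c * (f x * g x) + c\<^sup>2 * (g x)\<^sup>2)"
    using assms by (intro Bochner_Integration.integrable_add integrable_mult_right
        L2_square_integrable L2_mult_integrable)
  ultimately show ?thesis
    using assms[THEN L2_measurable] unfolding L2_def by simp
qed

section \<open>The fundamental lemma of the calculus of variations\<close>

lemma enn2real_inject: "enn2real a = enn2real b \<Longrightarrow> a \<noteq> \<infinity> \<Longrightarrow> b \<noteq> \<infinity> \<Longrightarrow> a = b"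
  by (cases a; cases b) auto

text \<open>The positive and negative parts of h are densities of two finite measures that agree on
  half-lines, hence coincide. Uniqueness of densities makes the two parts equal, so both
  vanish.\<close>

lemma AE_zero_if_interval_integrals_zero:
  fixes h :: "real \<Rightarrow> real"
  assumes h: "integrable unit_measure h"
    and zero: "\<And>a b. 0 \<le> a \<Longrightarrow> a < b \<Longrightarrow> b \<le> 1 \<Longrightarrow>
      (LINT x|unit_measure. indicator {a<..<b} x * h x) = 0"
  shows "AE x in unit_measure. h x = 0"
proof -
  define k where "k x = (if x \<in> {0<..<1} then h x else 0)" for x
  have k: "integrable lebesgue k"
    unfolding k_def[abs_def] by (rule Lebesgue_Measure.integrable_restrict_UNIV[THEN iffD2, OF _ h]) simp
  \<comment> \<open>A Borel representative is needed because agreement on half-lines determines a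
    measure on the Borel sets only.\<close>
  then obtain k' where k'[measurable]: "k' \<in> borel_measurable lborel" and "AE x in lborel. k x = k' x"
    using completion_ex_borel_measurable_real borel_measurable_integrable by metis
  then have eq: "AE x in lebesgue. k x = k' x" by (simp add: AE_completion)
  have "integrable lebesgue k'"
    using k eq by (subst Bochner_Integration.integrable_cong_AE[of _ _ k]) (auto intro: measurable_completion)
  then have int: "integrable lborel k'" by (simp add: integrable_completion)
  have half: "(LINT y|lborel. indicator {x<..} y * k' y) = 0" for x
  proof -
    have "(LINT y|lborel. indicator {x<..} y * k' y) = (LINT y|lebesgue. indicator {x<..} y * k' y)"
      by (rule integral_completion[symmetric]) measurable
    also have "\<dots> = (LINT y|lebesgue. indicator {x<..} y * k y)"
    proof (rule integral_cong_AE)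
      show "(\<lambda>y. indicator {x<..} y * k' y) \<in> borel_measurable lebesgue"
        by (rule measurable_completion) measurable
      show "(\<lambda>y. indicator {x<..} y * k y) \<in> borel_measurable lebesgue"
        by (intro borel_measurable_times borel_measurable_indicator borel_measurable_integrable[OF k]) simp
      show "AE y in lebesgue. indicator {x<..} y * k' y = indicator {x<..} y * k y"
        using eq by eventually_elim simp
    qed
    also have "\<dots> = (LINT y|lebesgue. (if y \<in> {0<..<1} then indicator {max 0 x<..<1} y * h y else 0))"
      by (rule arg_cong[where f = "integral\<^sup>L lebesgue"]) (auto simp: k_def indicator_def fun_eq_iff)
    also have "\<dots> = (LINT y|unit_measure. indicator {max 0 x<..<1} y * h y)"
      by (rule Lebesgue_Measure.integral_restrict_UNIV) simp
    also have "\<dots> = 0"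
    proof (cases "x < 1")
      case True then show ?thesis by (intro zero) auto
    next
      case False
      then have "{max 0 x<..<1} = {}" by auto
      then show ?thesis by simp
    qed
    finally show ?thesis .
  qed
  \<comment> \<open>The vanishing signed integral becomes an equality of two unsigned ones; their
    finiteness is what allows \<open>enn2real\<close> to be cancelled.\<close>
  have nn: "(\<integral>\<^sup>+y. ennreal (k' y) * indicator {x<..} y \<partial>lborel) < \<infinity> \<and>
    (\<integral>\<^sup>+y. ennreal (k' y) * indicator {x<..} y \<partial>lborel)
      = (\<integral>\<^sup>+y. ennreal (- k' y) * indicator {x<..} y \<partial>lborel)" for x
  proof -
    have i: "integrable lborel (\<lambda>y. indicator {x<..} y * k' y)"
      using integrable_mult_indicator[OF _ int, of "{x<..}"] by simp
    have eqs: "ennreal (k' y) * indicator {x<..} y = ennreal (indicator {x<..} y * k' y)"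
      "ennreal (- k' y) * indicator {x<..} y = ennreal (- (indicator {x<..} y * k' y))" for y
      by (auto simp: indicator_def)
    from i have fin: "(\<integral>\<^sup>+y. ennreal (indicator {x<..} y * k' y) \<partial>lborel) \<noteq> \<infinity>"
      "(\<integral>\<^sup>+y. ennreal (- (indicator {x<..} y * k' y)) \<partial>lborel) \<noteq> \<infinity>"
      unfolding real_integrable_def by auto
    have "enn2real (\<integral>\<^sup>+y. ennreal (indicator {x<..} y * k' y) \<partial>lborel)
        = enn2real (\<integral>\<^sup>+y. ennreal (- (indicator {x<..} y * k' y)) \<partial>lborel)"
      using half[of x] real_lebesgue_integral_def[OF i] by linarith
    then have "(\<integral>\<^sup>+y. ennreal (indicator {x<..} y * k' y) \<partial>lborel)
        = (\<integral>\<^sup>+y. ennreal (- (indicator {x<..} y * k' y)) \<partial>lborel)"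
      by (rule enn2real_inject[OF _ fin])
    with fin(1) show ?thesis
      unfolding eqs by (intro conjI) (simp_all add: top.not_eq_extremum)
  qed
  have "density lborel (\<lambda>x. ennreal (k' x)) = density lborel (\<lambda>x. ennreal (- k' x))"
  proof (rule measure_eqI_lessThan)
    fix x
    show "emeasure (density lborel (\<lambda>x. ennreal (k' x))) {x<..} < \<infinity>"
      using nn[of x] by (subst emeasure_density) auto
    show "emeasure (density lborel (\<lambda>x. ennreal (k' x))) {x<..} = emeasure (density lborel (\<lambda>x. ennreal (- k' x))) {x<..}"
      using nn[of x] by (subst (1 2) emeasure_density) auto
  qed simp_all
  then have "AE x in lborel. ennreal (k' x) = ennreal (- k' x)"
    by (intro sigma_finite_measure.density_unique[OF lborel.sigma_finite_measure_axioms]) auto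
  \<comment> \<open>\<open>ennreal\<close> truncates negative values to 0, so at each point one of
    the two equal sides is 0.\<close>
  then have "AE x in lborel. k' x = 0"
  proof eventually_elim
    case (elim x)
    then show ?case
      by (cases "k' x \<ge> 0") (auto simp: ennreal_neg ennreal_eq_0_iff dest: sym)
  qed
  then have "AE x in lebesgue. k' x = 0"
    by (rule AE_completion)
  with eq have "AE x in lebesgue. k x = 0"
    by eventually_elim simp
  then show ?thesis
    by (simp add: AE_restrict_space_iff k_def) (auto elim: AE_mp)
qed

text \<open>The functions \<open>step\<close> are test functions bounded by 1 that converge
  pointwise to the indicator of an interval; |h| dominates the products, so orthogonality passes to
  intervals.\<close>

lemma AE_zero_if_orthogonal_test_functions:
  assumes h: "integrable unit_measure h"
    and zero: "\<And>\<eta>. \<eta> \<in> test_functions \<Longrightarrow> (LINT x|unit_measure. h x * \<eta> x) = 0"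
  shows "AE x in unit_measure. h x = 0"
proof (rule AE_zero_if_interval_integrals_zero[OF h])
  fix a b :: real assume ab: "0 \<le> a" "a < b" "b \<le> 1"
  have [measurable]: "h \<in> borel_measurable unit_measure" using h by measurable
  have meas: "(\<lambda>x. step a b n x) \<in> borel_measurable unit_measure" for n
  proof -
    have "step a b n \<in> bump_algebra"
      unfolding step_def by (intro bump_algebra.intros)
    then obtain g where "\<And>x. (step a b n has_real_derivative g x) (at x)"
      using bump_algebra_derivative by blast
    then show ?thesis
      by (intro borel_measurable_unit continuous_at_imp_continuous_on) (blast intro: DERIV_isCont)
  qed
  have "(\<lambda>n. LINT x|unit_measure. step a b n x * h x) \<longlonglongrightarrow> (LINT x|unit_measure. indicator {a<..<b} x * h x)"
  proof (rule integral_dominated_convergence)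
    show "integrable unit_measure (\<lambda>x. \<bar>h x\<bar>)" using h by simp
    show "AE x in unit_measure. (\<lambda>n. step a b n x * h x) \<longlonglongrightarrow> indicator {a<..<b} x * h x"
      using ab by (intro AE_I2 tendsto_intros step_tendsto_indicator)
    show "AE x in unit_measure. norm (step a b n x * h x) \<le> \<bar>h x\<bar>" for n
      using abs_step_le by (intro AE_I2) (auto simp: abs_mult intro!: mult_left_le_one_le)
    have [measurable]: "indicat_real {a<..<b} \<in> borel_measurable unit_measure"
      by (rule measurable_restrict_space1, rule borel_measurable_indicator) simp
    show "(\<lambda>x. indicator {a<..<b} x * h x) \<in> borel_measurable unit_measure"
      by measurable
    show "(\<lambda>x. step a b n x * h x) \<in> borel_measurable unit_measure" for n
      using meas by measurable
  qed
  moreover have "(LINT x|unit_measure. step a b n x * h x) = 0" for n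
    using zero[OF step_mem_test_functions[OF ab], of n] by (simp add: mult.commute)
  ultimately show "(LINT x|unit_measure. indicator {a<..<b} x * h x) = 0"
    by (simp add: LIMSEQ_const_iff)
qed

section \<open>Test functions, weak derivatives and continuous representatives\<close>

lemma test_function_deriv:
  assumes "\<eta> \<in> test_functions"
  shows test_function_derivative: "(\<eta> has_real_derivative deriv \<eta> x) (at x)"
    and continuous_on_test_function: "continuous_on S \<eta>" "continuous_on S (deriv \<eta>)"
proof -
  obtain D where D0: "\<And>x. D 0 x = \<eta> x"
    and D: "\<And>n x. (D n has_real_derivative D (Suc n) x) (at x)"
    using assms by (auto simp: test_functions_def smooth_on_def)
  have "D 0 = \<eta>" using D0 by (rule ext)
  then have der: "(\<eta> has_real_derivative D 1 x) (at x)" for x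
    using D[of 0 x] by simp
  then have deriv: "deriv \<eta> = D 1"
    by (intro ext DERIV_imp_deriv)
  show "(\<eta> has_real_derivative deriv \<eta> x) (at x)" using der deriv by simp
  show "continuous_on S \<eta>"
    by (rule continuous_at_imp_continuous_on) (use DERIV_isCont[OF der] in blast)
  show "continuous_on S (deriv \<eta>)" unfolding deriv
    by (rule continuous_at_imp_continuous_on) (use DERIV_isCont[OF D] in blast)
qed

lemma test_function_boundary:
  assumes "\<eta> \<in> test_functions"
  shows "\<eta> 0 = 0" "\<eta> 1 = 0"
proof -
  have "{x. \<eta> x \<noteq> 0} \<subseteq> {0<..<1}"
    by (rule order_trans[OF closure_subset]) (use assms in \<open>simp add: test_functions_def\<close>)
  then show "\<eta> 0 = 0" "\<eta> 1 = 0" by auto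
qed

lemmas test_function_L2 = continuous_mem_L2[OF continuous_on_test_function(1)]
  continuous_mem_L2[OF continuous_on_test_function(2)]

lemma LINT_unit_eq_integral:
  fixes f :: "real \<Rightarrow> real"
  assumes "continuous_on {0..1} f"
  shows "(LINT x|unit_measure. f x) = integral {0..1} f"
  unfolding integral_open_interval_real
  by (rule lebesgue_integral_eq_integral[OF continuous_integrable_unit[OF assms]]) simp

lemma integral_derivative_unit:
  fixes f f' :: "real \<Rightarrow> real"
  assumes "\<And>x. x \<in> {0..1} \<Longrightarrow> (f has_real_derivative f' x) (at x within {0..1})" "y \<in> {0..1}"
  shows "(f' has_integral f y - f 0) {0..y}"
proof (rule fundamental_theorem_of_calculus)
  fix x assume "x \<in> {0..y}"
  then have "(f has_real_derivative f' x) (at x within {0..y})"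
    using assms by (intro DERIV_subset[OF assms(1)]) auto
  then show "(f has_vector_derivative f' x) (at x within {0..y})"
    by (simp add: has_real_derivative_iff_has_vector_derivative)
qed (use assms in auto)

lemma LINT_derivative_unit:
  fixes f f' :: "real \<Rightarrow> real"
  assumes "\<And>x. x \<in> {0..1} \<Longrightarrow> (f has_real_derivative f' x) (at x within {0..1})"
    and "continuous_on {0..1} f'"
  shows "(LINT x|unit_measure. f' x) = f 1 - f 0"
  unfolding LINT_unit_eq_integral[OF assms(2)]
  by (rule integral_unique, rule integral_derivative_unit[OF assms(1)]) auto

text \<open>The one-dimensional Sobolev embedding in elementary form. Applied to differences of test
  functions, it turns convergence of derivatives into uniform convergence.\<close>

lemma abs_le_LINT_abs_derivative:
  fixes f f' :: "real \<Rightarrow> real"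
  assumes der: "\<And>x. x \<in> {0..1} \<Longrightarrow> (f has_real_derivative f' x) (at x within {0..1})"
    and cont: "continuous_on {0..1} f'" and "f 0 = 0" and y: "y \<in> {0..1}"
  shows "\<bar>f y\<bar> \<le> (LINT x|unit_measure. \<bar>f' x\<bar>)"
proof -
  have c: "continuous_on {0..1} (\<lambda>x. \<bar>f' x\<bar>)" using cont by (intro continuous_intros)
  have cy: "continuous_on {0..y} (\<lambda>x. \<bar>f' x\<bar>)" using y by (intro continuous_on_subset[OF c]) auto
  have cfy: "continuous_on {0..y} f'" using y by (intro continuous_on_subset[OF cont]) auto
  have "f y = integral {0..y} f'"
    using integral_unique[OF integral_derivative_unit[OF der y]] assms(3) by simp
  also have "\<bar>\<dots>\<bar> \<le> integral {0..y} (\<lambda>x. \<bar>f' x\<bar>)"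
    using integral_norm_bound_integral[OF integrable_continuous_real[OF cfy] integrable_continuous_real[OF cy]]
    by simp
  also have "\<dots> \<le> integral {0..1} (\<lambda>x. \<bar>f' x\<bar>)"
    by (rule integral_subset_le[OF _ integrable_continuous_real[OF cy] integrable_continuous_real[OF c]])
      (use y in auto)
  also have "\<dots> = (LINT x|unit_measure. \<bar>f' x\<bar>)" using LINT_unit_eq_integral[OF c] by simp
  finally show ?thesis .
qed

text \<open>Integration by parts; the boundary terms vanish with the test function, so f itself may
  be nonzero at the ends, as a solution of the boundary value problem is.\<close>

lemma has_weak_deriv_if_derivative:
  fixes f f' :: "real \<Rightarrow> real"
  assumes der: "\<And>x. x \<in> {0..1} \<Longrightarrow> (f has_real_derivative f' x) (at x within {0..1})"
    and cont: "continuous_on {0..1} f'"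
  shows "has_weak_deriv f f'"
  unfolding has_weak_deriv_def
proof
  fix \<eta> assume \<eta>: "\<eta> \<in> test_functions"
  note c = continuous_on_test_function[OF \<eta>]
  have cf: "continuous_on {0..1} f" using der by (metis DERIV_continuous_on)
  have "((\<lambda>x. f x * \<eta> x) has_real_derivative f x * deriv \<eta> x + f' x * \<eta> x) (at x within {0..1})"
    if "x \<in> {0..1}" for x
    using has_field_derivative_at_within[OF test_function_derivative[OF \<eta>]] der[OF that]
    by (auto intro!: derivative_eq_intros)
  then have "(LINT x|unit_measure. f x * deriv \<eta> x + f' x * \<eta> x) = f 1 * \<eta> 1 - f 0 * \<eta> 0"
    using c cf cont by (intro LINT_derivative_unit continuous_intros) auto
  moreover have "(LINT x|unit_measure. f x * deriv \<eta> x + f' x * \<eta> x)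
      = (LINT x|unit_measure. f x * deriv \<eta> x) + (LINT x|unit_measure. f' x * \<eta> x)"
    using c cf cont
    by (intro Bochner_Integration.integral_add continuous_integrable_unit continuous_intros)
  ultimately show "(LINT x|unit_measure. f x * deriv \<eta> x) = - (LINT x|unit_measure. f' x * \<eta> x)"
    using test_function_boundary[OF \<eta>] by simp
qed

lemma has_weak_deriv_add:
  assumes "has_weak_deriv u g" "has_weak_deriv v h" "u \<in> L2" "g \<in> L2" "v \<in> L2" "h \<in> L2"
  shows "has_weak_deriv (\<lambda>x. u x + c * v x) (\<lambda>x. g x + c * h x)"
  unfolding has_weak_deriv_def
proof
  fix \<eta> assume \<eta>: "\<eta> \<in> test_functions"
  note t = test_function_L2[OF \<eta>]
  have lin: "(LINT x|unit_measure. (a x + c * b x) * \<zeta> x)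
      = (LINT x|unit_measure. a x * \<zeta> x) + c * (LINT x|unit_measure. b x * \<zeta> x)"
    if "a \<in> L2" "b \<in> L2" "\<zeta> \<in> L2" for a b \<zeta>
    using L2_mult_integrable[OF that(1,3)] L2_mult_integrable[OF that(2,3)]
    by (simp add: distrib_right mult.assoc Bochner_Integration.integral_add)
  show "(LINT x|unit_measure. (u x + c * v x) * deriv \<eta> x)
      = - (LINT x|unit_measure. (g x + c * h x) * \<eta> x)"
    using assms t \<eta> by (simp add: lin has_weak_deriv_def)
qed

lemma has_weak_deriv_unique:
  assumes "has_weak_deriv u g" "has_weak_deriv u h" "g \<in> L2" "h \<in> L2"
  shows "AE x in unit_measure. g x = h x"
proof -
  have d: "(\<lambda>x. g x - h x) \<in> L2" using L2_add[OF assms(3,4), of "-1"] by simp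
  have "AE x in unit_measure. g x - h x = 0"
  proof (rule AE_zero_if_orthogonal_test_functions[OF L2_integrable[OF d]])
    fix \<eta> assume \<eta>: "\<eta> \<in> test_functions"
    have "(LINT x|unit_measure. (g x - h x) * \<eta> x)
        = (LINT x|unit_measure. g x * \<eta> x) - (LINT x|unit_measure. h x * \<eta> x)"
      using L2_mult_integrable[OF assms(3) test_function_L2(1)[OF \<eta>]]
        L2_mult_integrable[OF assms(4) test_function_L2(1)[OF \<eta>]]
      by (simp add: left_diff_distrib Bochner_Integration.integral_diff)
    then show "(LINT x|unit_measure. (g x - h x) * \<eta> x) = 0"
      using assms(1,2) \<eta> by (simp add: has_weak_deriv_def)
  qed
  then show ?thesis by simp
qed

text \<open>Under an integral the derivative selected by \<open>SOME\<close> may be exchanged for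
  any explicitly known weak derivative in \<open>L2\<close>.\<close>

lemma weak_deriv_AE_eq:
  assumes "has_weak_deriv u g" "g \<in> L2"
  shows "weak_deriv u \<in> L2" "AE x in unit_measure. weak_deriv u x = g x"
proof -
  have "weak_deriv u \<in> L2 \<and> has_weak_deriv u (weak_deriv u)"
    unfolding weak_deriv_def by (rule someI[of _ g]) (intro conjI assms)
  then show "weak_deriv u \<in> L2" "AE x in unit_measure. weak_deriv u x = g x"
    using has_weak_deriv_unique assms by blast+
qed

text \<open>The continuous function |v - w| has integral 0 and therefore vanishes everywhere,
  endpoints included. This is what gives the boundary values of \<open>cont_rep\<close> a
  meaning.\<close>

lemma AE_unit_eq_imp_eq:
  fixes v w :: "real \<Rightarrow> real"
  assumes ae: "AE x in unit_measure. v x = w x"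
    and cont: "continuous_on {0..1} v" "continuous_on {0..1} w" and x: "x \<in> {0..1}"
  shows "v x = w x"
proof -
  have "(LINT x|unit_measure. \<bar>v x - w x\<bar>) = (LINT x|unit_measure. 0)"
    using ae cont by (intro integral_cong_AE) (auto intro!: borel_measurable_unit continuous_intros)
  then have "integral {0..1} (\<lambda>x. \<bar>v x - w x\<bar>) = 0"
    using cont by (subst LINT_unit_eq_integral[symmetric]) (auto intro!: continuous_intros)
  then have "\<bar>v x - w x\<bar> = 0"
    by (subst (asm) integral_eq_0_iff) (use x in \<open>auto intro!: continuous_intros cont\<close>)
  then show ?thesis by simp
qed

lemma cont_rep_eq:
  assumes "continuous_on {0..1} v" "AE x in unit_measure. v x = u x" "x \<in> {0..1}"
  shows "cont_rep u x = v x"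
proof -
  have *: "continuous_on {0..1} (cont_rep u) \<and> (AE x in unit_measure. cont_rep u x = u x)"
    unfolding cont_rep_def by (rule someI[of _ v]) (intro conjI assms)
  then have "AE x in unit_measure. cont_rep u x = u x" by simp
  with assms(2) have "AE x in unit_measure. cont_rep u x = v x"
    by eventually_elim simp
  then show ?thesis
    using * by (intro AE_unit_eq_imp_eq[OF _ _ assms(1,3)]) auto
qed

section \<open>Cauchy-Schwarz and Sobolev limits of test functions\<close>

lemma LINT_unit_const: "(LINT x|unit_measure. c) = (c :: real)"
  unfolding LINT_unit_eq_integral[OF continuous_on_const] by simp

lemma Cauchy_Schwarz_unit:
  assumes "f \<in> L2" "h \<in> L2"
  shows "(LINT x|unit_measure. f x * h x)\<^sup>2 \<le> (LINT x|unit_measure. (f x)\<^sup>2) * (LINT x|unit_measure. (h x)\<^sup>2)"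
proof -
  define a b c where "a = (LINT x|unit_measure. (f x)\<^sup>2)" and "b = (LINT x|unit_measure. f x * h x)"
    and "c = (LINT x|unit_measure. (h x)\<^sup>2)"
  note i = L2_square_integrable[OF assms(1)] L2_square_integrable[OF assms(2)] L2_mult_integrable[OF assms]
  have quad: "0 \<le> a + 2 * t * b + t\<^sup>2 * c" for t
  proof -
    have "0 \<le> (LINT x|unit_measure. (f x + t * h x)\<^sup>2)" by simp
    also have "\<dots> = (LINT x|unit_measure. (f x)\<^sup>2 + 2 * t * (f x * h x) + t\<^sup>2 * (h x)\<^sup>2)"
      by (simp add: power2_sum power_mult_distrib algebra_simps)
    also have "\<dots> = a + 2 * t * b + t\<^sup>2 * c"
      using i by (simp add: Bochner_Integration.integral_add a_def b_def c_def)
    finally show ?thesis .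
  qed
  have "c \<ge> 0" by (simp add: c_def)
  have "b\<^sup>2 \<le> a * c"
  proof (cases "c = 0")
    case True
    have "b = 0"
    proof (rule ccontr)
      assume "b \<noteq> 0"
      \<comment> \<open>With c = 0 the quadratic is affine in t, and this t gives it the value
        -1.\<close>
      then show False
        using quad[of "- (a + 1) / (2 * b)"] True by (simp add: field_simps)
    qed
    then show ?thesis using True by simp
  next
    case False
    \<comment> \<open>The minimiser t = -b/c of the quadratic, cleared of its denominator.\<close>
    then have "0 \<le> (a + 2 * (- b / c) * b + (- b / c)\<^sup>2 * c) * c"
      using quad \<open>c \<ge> 0\<close> by (intro mult_nonneg_nonneg)
    also have "\<dots> = a * c - b\<^sup>2"
      using False by (simp add: field_simps power2_eq_square)
    finally show ?thesis by simp
  qed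
  then show ?thesis by (simp add: a_def b_def c_def)
qed

lemma LINT_abs_squared_le:
  assumes "f \<in> L2"
  shows "(LINT x|unit_measure. \<bar>f x\<bar>)\<^sup>2 \<le> (LINT x|unit_measure. (f x)\<^sup>2)"
proof -
  have "(\<lambda>x. \<bar>f x\<bar>) \<in> L2" using assms by (auto simp: L2_def intro: borel_measurable_abs)
  from Cauchy_Schwarz_unit[OF this continuous_mem_L2[OF continuous_on_const[of _ 1]]]
  show ?thesis by (simp only: LINT_unit_const power2_abs power_one mult_1_right)
qed

text \<open>Test functions converging in the Sobolev norm converge uniformly, which yields a continuous
  representative vanishing at both endpoints.\<close>

lemma W12_0_representative:
  assumes "\<phi> \<in> W12_0"
  obtains v g \<eta> where "continuous_on {0..1} v" "v 0 = 0" "v 1 = 0" "AE x in unit_measure. v x = \<phi> x"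
    "\<phi> \<in> L2" "g \<in> L2" "has_weak_deriv \<phi> g" "\<And>n. \<eta> n \<in> test_functions"
    "(\<lambda>n. LINT x|unit_measure. (v x - \<eta> n x)\<^sup>2) \<longlonglongrightarrow> 0"
    "(\<lambda>n. LINT x|unit_measure. (g x - deriv (\<eta> n) x)\<^sup>2) \<longlonglongrightarrow> 0"
proof -
  obtain g \<eta> where \<phi>: "\<phi> \<in> L2" and g: "g \<in> L2" "has_weak_deriv \<phi> g"
    and \<eta>: "\<And>n. \<eta> n \<in> test_functions"
    and lim: "(\<lambda>n. W12_norm (\<lambda>x. \<phi> x - \<eta> n x)) \<longlonglongrightarrow> 0"
    using assms by (auto simp: W12_0_def W12_def)
  note t = test_function_L2[OF \<eta>] and c = continuous_on_test_function[OF \<eta>]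
  have \<eta>_wd: "has_weak_deriv (\<eta> n) (deriv (\<eta> n))" for n
    using test_function_derivative[OF \<eta>] c
    by (intro has_weak_deriv_if_derivative) (auto intro: has_field_derivative_at_within)
  \<comment> \<open>Frees the norm from the weak derivative chosen separately for each n: one fixed
    g serves for the whole sequence.\<close>
  have norm_eq: "(W12_norm (\<lambda>x. \<phi> x - \<eta> n x))\<^sup>2
    = (LINT x|unit_measure. (\<phi> x - \<eta> n x)\<^sup>2) + (LINT x|unit_measure. (g x - deriv (\<eta> n) x)\<^sup>2)" for n
  proof -
    have wd: "has_weak_deriv (\<lambda>x. \<phi> x - \<eta> n x) (\<lambda>x. g x - deriv (\<eta> n) x)"
      using has_weak_deriv_add[OF g(2) \<eta>_wd \<phi> g(1) t, of "-1"] by simp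
    have L: "(\<lambda>x. g x - deriv (\<eta> n) x) \<in> L2"
      using L2_add[OF g(1) t(2), of "-1"] by simp
    have "(LINT x|unit_measure. (weak_deriv (\<lambda>x. \<phi> x - \<eta> n x) x)\<^sup>2)
      = (LINT x|unit_measure. (g x - deriv (\<eta> n) x)\<^sup>2)"
      using weak_deriv_AE_eq[OF wd L] L
      by (intro integral_cong_AE) (auto intro!: L2_measurable borel_measurable_power)
    then show ?thesis by (simp add: W12_norm_def)
  qed
  have lim2: "(\<lambda>n. (W12_norm (\<lambda>x. \<phi> x - \<eta> n x))\<^sup>2) \<longlonglongrightarrow> 0"
    using tendsto_power[OF lim, of 2] by simp
  have lim_\<phi>: "(\<lambda>n. LINT x|unit_measure. (\<phi> x - \<eta> n x)\<^sup>2) \<longlonglongrightarrow> 0"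
    by (rule tendsto_sandwich[OF _ _ tendsto_const lim2]) (auto simp: norm_eq)
  have lim_g: "(\<lambda>n. LINT x|unit_measure. (g x - deriv (\<eta> n) x)\<^sup>2) \<longlonglongrightarrow> 0"
    by (rule tendsto_sandwich[OF _ _ tendsto_const lim2]) (auto simp: norm_eq)
  define r where "r n = sqrt (LINT x|unit_measure. (g x - deriv (\<eta> n) x)\<^sup>2)" for n
  have r: "r \<longlonglongrightarrow> 0" unfolding r_def using tendsto_real_sqrt[OF lim_g] by simp
  have gL: "(\<lambda>x. g x - deriv (\<eta> n) x) \<in> L2" for n
    using L2_add[OF g(1) t(2), of "-1"] by simp
  have L1: "(LINT x|unit_measure. \<bar>g x - deriv (\<eta> n) x\<bar>) \<le> r n" for n
    unfolding r_def using LINT_abs_squared_le[OF gL] by (rule real_le_rsqrt)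
  \<comment> \<open>Both derivatives are compared with g. Since all test functions vanish at 0, the
    L1 distance of the derivatives bounds the pointwise distance.\<close>
  have diff: "\<bar>\<eta> m y - \<eta> n y\<bar> \<le> r m + r n" if "y \<in> {0..1}" for m n y
  proof -
    have "\<bar>\<eta> m y - \<eta> n y\<bar> \<le> (LINT x|unit_measure. \<bar>deriv (\<eta> m) x - deriv (\<eta> n) x\<bar>)"
    proof (rule abs_le_LINT_abs_derivative[where f = "\<lambda>y. \<eta> m y - \<eta> n y"])
      show "((\<lambda>y. \<eta> m y - \<eta> n y) has_real_derivative deriv (\<eta> m) x - deriv (\<eta> n) x) (at x within {0..1})" for x
        by (intro DERIV_diff has_field_derivative_at_within[OF test_function_derivative[OF \<eta>]])
    qed (use that c test_function_boundary[OF \<eta>] in \<open>auto intro!: continuous_intros\<close>)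
    also have "\<dots> \<le> (LINT x|unit_measure. \<bar>g x - deriv (\<eta> m) x\<bar> + \<bar>g x - deriv (\<eta> n) x\<bar>)"
    proof (intro integral_mono)
      show "integrable unit_measure (\<lambda>x. \<bar>deriv (\<eta> m) x - deriv (\<eta> n) x\<bar>)"
        by (intro continuous_integrable_unit continuous_intros c)
      show "integrable unit_measure (\<lambda>x. \<bar>g x - deriv (\<eta> m) x\<bar> + \<bar>g x - deriv (\<eta> n) x\<bar>)"
        by (intro Bochner_Integration.integrable_add integrable_abs L2_integrable[OF gL])
    qed auto
    also have "\<dots> = (LINT x|unit_measure. \<bar>g x - deriv (\<eta> m) x\<bar>) + (LINT x|unit_measure. \<bar>g x - deriv (\<eta> n) x\<bar>)"
      using L2_integrable[OF gL] by (intro Bochner_Integration.integral_add integrable_abs)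
    also have "\<dots> \<le> r m + r n" by (intro add_mono L1)
    finally show ?thesis .
  qed
  have "uniformly_Cauchy_on {0..1} \<eta>"
    unfolding uniformly_Cauchy_on_def
  proof (intro allI impI)
    fix e :: real assume "e > 0"
    then obtain M where M: "\<And>n. n \<ge> M \<Longrightarrow> r n < e / 2"
      using order_tendstoD(2)[OF r, of "e / 2"] by (auto simp: eventually_sequentially)
    have "dist (\<eta> m y) (\<eta> n y) < e" if "y \<in> {0..1}" "m \<ge> M" "n \<ge> M" for y m n
      using diff[OF that(1), of m n] M[OF that(2)] M[OF that(3)] by (simp add: dist_real_def)
    then show "\<exists>M. \<forall>x\<in>{0..1}. \<forall>m\<ge>M. \<forall>n\<ge>M. dist (\<eta> m x) (\<eta> n x) < e" by blast
  qed
  then obtain v where v: "uniform_limit {0..1} \<eta> v sequentially"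
    using Cauchy_uniformly_convergent uniformly_convergent_on_def by blast
  have cv: "continuous_on {0..1} v"
    using c v by (intro uniform_limit_theorem[OF _ v]) auto
  have pt: "(\<lambda>n. \<eta> n x) \<longlonglongrightarrow> v x" if "x \<in> {0..1}" for x
    using tendsto_uniform_limitI[OF v that] .
  have bd: "v 0 = 0" "v 1 = 0"
    using pt[of 0] pt[of 1] test_function_boundary[OF \<eta>] by (auto simp: LIMSEQ_const_iff)
  have vL: "(\<lambda>x. v x - \<eta> n x) \<in> L2" for n
    using cv c by (intro continuous_mem_L2 continuous_intros)
  have lim_v: "(\<lambda>n. LINT x|unit_measure. (v x - \<eta> n x)\<^sup>2) \<longlonglongrightarrow> 0"
  proof -
    have "\<bar>v y - \<eta> n y\<bar> \<le> r n" if "y \<in> {0..1}" for y n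
    proof -
      \<comment> \<open>Letting m tend to infinity in \<open>diff\<close> gives a uniform rate of
        convergence to v.\<close>
      have "(\<lambda>m. \<bar>\<eta> m y - \<eta> n y\<bar>) \<longlonglongrightarrow> \<bar>v y - \<eta> n y\<bar>"
        by (intro tendsto_intros pt[OF that])
      moreover have "(\<lambda>m. r m + r n) \<longlonglongrightarrow> 0 + r n"
        by (intro tendsto_intros r)
      ultimately have "\<bar>v y - \<eta> n y\<bar> \<le> 0 + r n"
        by (rule LIMSEQ_le) (use diff[OF that] in blast)
      then show ?thesis by simp
    qed
    then have "(v y - \<eta> n y)\<^sup>2 \<le> (r n)\<^sup>2" if "y \<in> {0..1}" for y n
      using that by (metis abs_ge_zero power2_abs power_mono)
    then have "(LINT x|unit_measure. (v x - \<eta> n x)\<^sup>2) \<le> (LINT x|unit_measure. (r n)\<^sup>2)" for n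
      by (intro integral_mono L2_square_integrable[OF vL] const_integrable_unit) auto
    then have le_r: "(LINT x|unit_measure. (v x - \<eta> n x)\<^sup>2) \<le> (r n)\<^sup>2" for n
      unfolding LINT_unit_const .
    have lim_r: "(\<lambda>n. (r n)\<^sup>2) \<longlonglongrightarrow> 0"
      using tendsto_power[OF r, of 2] by simp
    show ?thesis
      by (rule tendsto_sandwich[OF _ _ tendsto_const lim_r]) (use le_r in auto)
  qed
  have dL: "(\<lambda>x. v x - \<phi> x) \<in> L2"
    using L2_add[OF continuous_mem_L2[OF cv] \<phi>, of "-1"] by simp
  have \<phi>L: "(\<lambda>x. \<phi> x - \<eta> n x) \<in> L2" for n
    using L2_add[OF \<phi> t(1), of "-1"] by simp
  \<comment> \<open>v and phi are L2 limits of the same sequence, so they agree almost everywhere;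
    (a - b)^2 <= 2 a^2 + 2 b^2 compares them.\<close>
  have "(LINT x|unit_measure. (v x - \<phi> x)\<^sup>2)
      \<le> 2 * (LINT x|unit_measure. (v x - \<eta> n x)\<^sup>2) + 2 * (LINT x|unit_measure. (\<phi> x - \<eta> n x)\<^sup>2)" for n
  proof -
    note i = L2_square_integrable[OF vL, of n] L2_square_integrable[OF \<phi>L, of n]
    have "(v x - \<phi> x)\<^sup>2 \<le> 2 * (v x - \<eta> n x)\<^sup>2 + 2 * (\<phi> x - \<eta> n x)\<^sup>2" for x
      using sum_squares_bound[of "v x - \<eta> n x" "- (\<phi> x - \<eta> n x)"]
      by (simp add: power2_eq_square algebra_simps)
    then have "(LINT x|unit_measure. (v x - \<phi> x)\<^sup>2)
      \<le> (LINT x|unit_measure. 2 * (v x - \<eta> n x)\<^sup>2 + 2 * (\<phi> x - \<eta> n x)\<^sup>2)"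
      using i L2_square_integrable[OF dL] by (intro integral_mono) auto
    also have "\<dots> = 2 * (LINT x|unit_measure. (v x - \<eta> n x)\<^sup>2) + 2 * (LINT x|unit_measure. (\<phi> x - \<eta> n x)\<^sup>2)"
      using i by (simp add: Bochner_Integration.integral_add)
    finally show ?thesis .
  qed
  note le = this
  have lim_sum: "(\<lambda>n. 2 * (LINT x|unit_measure. (v x - \<eta> n x)\<^sup>2)
      + 2 * (LINT x|unit_measure. (\<phi> x - \<eta> n x)\<^sup>2)) \<longlonglongrightarrow> 2 * 0 + 2 * 0"
    by (intro tendsto_intros lim_v lim_\<phi>)
  have "(LINT x|unit_measure. (v x - \<phi> x)\<^sup>2) \<le> 2 * 0 + 2 * 0"
    by (rule LIMSEQ_le_const[OF lim_sum]) (use le in blast)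
  then have "(LINT x|unit_measure. (v x - \<phi> x)\<^sup>2) = 0"
    by (intro order.antisym[OF _ Bochner_Integration.integral_nonneg]) auto
  then have "AE x in unit_measure. (v x - \<phi> x)\<^sup>2 = 0"
    using integral_nonneg_eq_0_iff_AE[OF L2_square_integrable[OF dL]] by simp
  then have "AE x in unit_measure. v x = \<phi> x" by simp
  then show ?thesis
    by (rule that[OF cv bd _ \<phi> g \<eta> lim_v lim_g])
qed

section \<open>Monotonicity of solutions\<close>

lemma DERIV_elastic:
  assumes "(f has_real_derivative f') (at x within S)"
  shows "((\<lambda>x. elastic \<kappa> (f x)) has_real_derivative (1 - \<kappa>) * sin (2 * f x) * f') (at x within S)"
  unfolding elastic_def sin_double
  by (auto intro!: derivative_eq_intros assms simp: algebra_simps)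

lemma elastic_eq: "elastic \<kappa> t = \<kappa> + (1 - \<kappa>) * (sin t)\<^sup>2"
  by (simp add: elastic_def cos_squared_eq algebra_simps)

lemma elastic_pos:
  assumes "0 < \<kappa>" "\<kappa> < 1"
  shows "0 < elastic \<kappa> t"
  unfolding elastic_eq using assms by (intro add_pos_nonneg mult_nonneg_nonneg) auto

text \<open>One-sided derivatives on a nondegenerate interval are unique, so the functions supplied
  by \<open>smooth_on\<close> can replace \<open>unit_deriv\<close>, also at the endpoints, where
  the boundary conditions are imposed.\<close>

lemma bvp_solution_derivatives:
  assumes "bvp_solution W E l \<kappa> \<theta>"
  obtains p q where
    "\<And>x. x \<in> {0..1} \<Longrightarrow> (\<theta> has_real_derivative p x) (at x within {0..1})"
    "\<And>x. x \<in> {0..1} \<Longrightarrow> (p has_real_derivative q x) (at x within {0..1})"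
    "continuous_on {0..1} q"
    "\<And>x. x \<in> {0..1} \<Longrightarrow> \<theta> x \<in> {0..pi}"
    "\<And>x. x \<in> {0<..<1} \<Longrightarrow> elastic \<kappa> (\<theta> x) * q x + 1/2 * (1 - \<kappa>) * sin (2 * \<theta> x) * (p x)\<^sup>2
        + 1/2 * l\<^sup>2 * sin (2 * \<theta> x) - E * l\<^sup>2 * sin (\<theta> x) = 0"
    "elastic \<kappa> (\<theta> 0) * p 0 = W * l * sin (\<theta> 0)"
    "elastic \<kappa> (\<theta> 1) * p 1 = W * l * sin (\<theta> 1)"
proof -
  obtain D where D0: "\<And>x. x \<in> {0..1} \<Longrightarrow> D 0 x = \<theta> x"
    and D: "\<And>n x. x \<in> {0..1} \<Longrightarrow> (D n has_real_derivative D (Suc n) x) (at x within {0..1})"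
    using assms unfolding bvp_solution_def smooth_on_def by blast
  have \<theta>: "(\<theta> has_real_derivative D 1 x) (at x within {0..1})" if "x \<in> {0..1}" for x
    using has_field_derivative_transform_within[OF D[OF that, of 0] zero_less_one that, of \<theta>] D0 by simp
  have ud: "unit_deriv f x = f'"
    if "(f has_real_derivative f') (at x within {0..1})" "x \<in> {0..1}" for f f' x
    using that vector_derivative_within_cbox[of 0 1 x f f']
    by (simp add: has_real_derivative_iff_has_vector_derivative)
  have ud1: "unit_deriv \<theta> x = D 1 x" if "x \<in> {0..1}" for x
    using ud[OF \<theta>] that by blast
  have "(unit_deriv \<theta> has_real_derivative D (Suc 1) x) (at x within {0..1})" if "x \<in> {0..1}" for x
    using has_field_derivative_transform_within[OF D[OF that, of 1] zero_less_one that, of "unit_deriv \<theta>"]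
    by (simp add: ud1)
  then have ud2: "unit_deriv (unit_deriv \<theta>) x = D (Suc 1) x" if "x \<in> {0..1}" for x
    using ud that by blast
  show ?thesis
  proof (rule that[of "D 1" "D (Suc 1)"])
    show "continuous_on {0..1} (D (Suc 1))"
      using D by (rule DERIV_continuous_on)
    show "\<theta> x \<in> {0..pi}" if "x \<in> {0..1}" for x
      using assms that unfolding bvp_solution_def by blast
    show "elastic \<kappa> (\<theta> x) * D (Suc 1) x + 1/2 * (1 - \<kappa>) * sin (2 * \<theta> x) * (D 1 x)\<^sup>2
        + 1/2 * l\<^sup>2 * sin (2 * \<theta> x) - E * l\<^sup>2 * sin (\<theta> x) = 0" if "x \<in> {0<..<1}" for x
    proof -
      have "x \<in> {0..1}" using that by auto
      then show ?thesis
        using assms that ud1 ud2 unfolding bvp_solution_def by force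
    qed
    show "elastic \<kappa> (\<theta> 0) * D 1 0 = W * l * sin (\<theta> 0)" "elastic \<kappa> (\<theta> 1) * D 1 1 = W * l * sin (\<theta> 1)"
      using assms ud1[of 0] ud1[of 1] unfolding bvp_solution_def by auto
  qed (use \<theta> D in blast)+
qed

lemma zero_deriv_const_on_unit:
  fixes f :: "real \<Rightarrow> real"
  assumes "continuous_on {0..1} f" "\<And>x. x \<in> {0<..<1} \<Longrightarrow> (f has_real_derivative 0) (at x)"
    and "x \<in> {0..1}"
  shows "f x = f 0"
proof (cases "x = 0")
  case False
  then show ?thesis
    using assms
    by (intro DERIV_isconst2[of 0 1 f x]) auto
qed simp

text \<open>Gronwall's argument for backward uniqueness.\<close>

lemma zero_at_left_end_if_linear_bound:
  fixes f f' :: "real \<Rightarrow> real"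
  assumes der: "\<And>x. x \<in> {0..1} \<Longrightarrow> (f has_real_derivative f' x) (at x within {0..1})"
    and bound: "\<And>x. x \<in> {0..1} \<Longrightarrow> \<bar>f' x\<bar> \<le> K * \<bar>f x\<bar>"
    and y: "y \<in> {0..1}" "f y = 0"
  shows "f 0 = 0"
proof -
  \<comment> \<open>The hypothesis gives (f^2)' >= -2 K f^2, and the exponential weight turns this
    into monotonicity; the value 0 at y then bounds the one at 0.\<close>
  have "(f 0)\<^sup>2 * exp (2 * K * 0) \<le> (f y)\<^sup>2 * exp (2 * K * y)"
  proof (rule DERIV_nonneg_imp_increasing_open[where f = "\<lambda>x. (f x)\<^sup>2 * exp (2 * K * x)"])
    show "\<exists>d. ((\<lambda>x. (f x)\<^sup>2 * exp (2 * K * x)) has_real_derivative d) (at x) \<and> 0 \<le> d"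
      if "0 < x" "x < y" for x
    proof -
      have x: "x \<in> {0..1}" "x \<in> {0<..<1}" using that y by auto
      have "(f has_real_derivative f' x) (at x)"
        using der[OF x(1)] x(2) at_within_Icc_at[of 0 x 1] by auto
      then have "((\<lambda>x. (f x)\<^sup>2 * exp (2 * K * x)) has_real_derivative
          2 * (f x * f' x + K * (f x)\<^sup>2) * exp (2 * K * x)) (at x)"
        by (auto intro!: derivative_eq_intros simp: algebra_simps)
      moreover have "- (f x * f' x) \<le> K * (f x)\<^sup>2"
      proof -
        have "- (f x * f' x) \<le> \<bar>f x\<bar> * \<bar>f' x\<bar>" by (simp flip: abs_mult)
        also have "\<dots> \<le> \<bar>f x\<bar> * (K * \<bar>f x\<bar>)" by (intro mult_left_mono bound x) auto
        finally show ?thesis by (simp add: power2_eq_square algebra_simps)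
      qed
      ultimately show ?thesis by (intro exI conjI) auto
    qed
    have "continuous_on {0..1} f" using der by (rule DERIV_continuous_on)
    then show "continuous_on {0..y} (\<lambda>x. (f x)\<^sup>2 * exp (2 * K * x))"
      using y by (intro continuous_intros) (auto elim: continuous_on_subset)
  qed (use y in auto)
  then show ?thesis using y by simp
qed

lemma bvp_solution_strictly_increasing:
  fixes \<theta> p q :: "real \<Rightarrow> real"
  assumes pos: "W > 0" "l \<ge> 1" "0 < \<kappa>" "\<kappa> < 1"
    and \<theta>: "\<And>x. x \<in> {0..1} \<Longrightarrow> (\<theta> has_real_derivative p x) (at x within {0..1})"
    and p: "\<And>x. x \<in> {0..1} \<Longrightarrow> (p has_real_derivative q x) (at x within {0..1})"
    and range: "\<And>x. x \<in> {0..1} \<Longrightarrow> \<theta> x \<in> {0..pi}"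
    and ode: "\<And>x. x \<in> {0<..<1} \<Longrightarrow> elastic \<kappa> (\<theta> x) * q x
        + 1/2 * (1 - \<kappa>) * sin (2 * \<theta> x) * (p x)\<^sup>2 + 1/2 * l\<^sup>2 * sin (2 * \<theta> x) = 0"
    and bc0: "elastic \<kappa> (\<theta> 0) * p 0 = W * l * sin (\<theta> 0)"
    and bc1: "elastic \<kappa> (\<theta> 1) * p 1 = W * l * sin (\<theta> 1)"
    and nonconst: "\<not> \<theta> constant_on {0..1}"
    and x: "x \<in> {0..1}"
  shows "p x > 0"
proof -
  let ?e = "\<lambda>x. elastic \<kappa> (\<theta> x)"
  have e: "?e x > 0" for x using elastic_pos pos by blast
  have at: "(f has_real_derivative f') (at x)"
    if "(f has_real_derivative f') (at x within {0..1})" "x \<in> {0<..<1}" for f f' and x :: real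
    using that at_within_Icc_at[of 0 x 1] by auto
  have sin_nonneg: "sin (\<theta> x) \<ge> 0" if "x \<in> {0..1}" for x
    using range[OF that] by (intro sin_ge_zero) auto
  have cont\<theta>: "continuous_on {0..1} \<theta>" using \<theta> by (rule DERIV_continuous_on)
  have contp: "continuous_on {0..1} p" using p by (rule DERIV_continuous_on)
  have conte: "continuous_on {0..1} ?e"
    unfolding elastic_def by (intro continuous_intros cont\<theta>)
  define C where "C = ?e 0 * (p 0)\<^sup>2 + l\<^sup>2 * (sin (\<theta> 0))\<^sup>2"
  have energy: "?e x * (p x)\<^sup>2 + l\<^sup>2 * (sin (\<theta> x))\<^sup>2 = C" if "x \<in> {0..1}" for x
    unfolding C_def
  proof (rule zero_deriv_const_on_unit[OF _ _ that, where f = "\<lambda>x. ?e x * (p x)\<^sup>2 + l\<^sup>2 * (sin (\<theta> x))\<^sup>2"])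
    show "continuous_on {0..1} (\<lambda>x. ?e x * (p x)\<^sup>2 + l\<^sup>2 * (sin (\<theta> x))\<^sup>2)"
      by (intro continuous_intros conte contp cont\<theta>)
    fix x :: real assume x: "x \<in> {0<..<1}"
    then have x': "x \<in> {0..1}" by auto
    note d = at[OF \<theta>[OF x'] x] at[OF p[OF x'] x] DERIV_elastic[OF at[OF \<theta>[OF x'] x]]
    \<comment> \<open>The derivative of the first integral is 2 p times the left-hand side of the
      equation.\<close>
    have "((\<lambda>x. ?e x * (p x)\<^sup>2 + l\<^sup>2 * (sin (\<theta> x))\<^sup>2) has_real_derivative
        2 * p x * (?e x * q x + 1/2 * (1 - \<kappa>) * sin (2 * \<theta> x) * (p x)\<^sup>2 + 1/2 * l\<^sup>2 * sin (2 * \<theta> x))) (at x)"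
      unfolding sin_double
      by (auto intro!: derivative_eq_intros d[unfolded sin_double] simp: power2_eq_square field_simps)
    then show "((\<lambda>x. ?e x * (p x)\<^sup>2 + l\<^sup>2 * (sin (\<theta> x))\<^sup>2) has_real_derivative 0) (at x)"
      using ode[OF x] by simp
  qed
  \<comment> \<open>W > 0 and sin theta >= 0 make p(0) nonnegative. If it were 0, the boundary
    condition would give sin theta(0) = 0, hence C = 0; both nonnegative summands would vanish
    throughout and theta would be constant.\<close>
  have p0: "p 0 > 0"
  proof (rule ccontr)
    assume "\<not> p 0 > 0"
    moreover have "?e 0 * p 0 \<ge> 0"
      unfolding bc0 using pos sin_nonneg[of 0] by (intro mult_nonneg_nonneg) auto
    ultimately have "p 0 = 0" using e[of 0] by (simp add: zero_le_mult_iff)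
    moreover from this have "sin (\<theta> 0) = 0" using bc0 pos by simp
    ultimately have "C = 0" by (simp add: C_def)
    have "p x = 0" if "x \<in> {0..1}" for x
    proof -
      have "?e x * (p x)\<^sup>2 \<ge> 0" "l\<^sup>2 * (sin (\<theta> x))\<^sup>2 \<ge> 0" using e[of x] by simp_all
      then have "?e x * (p x)\<^sup>2 = 0" using energy[OF that] \<open>C = 0\<close> by linarith
      then show ?thesis using e[of x] by simp
    qed
    then have "\<theta> x = \<theta> 0" if "x \<in> {0..1}" for x
      using zero_deriv_const_on_unit[OF cont\<theta> _ that] at[OF \<theta>]
      by (metis atLeastAtMost_iff greaterThanLessThan_iff less_imp_le)
    then show False using nonconst unfolding constant_on_def by blast
  qed
  \<comment> \<open>Once p is eliminated, C depends on the end only through sin^2 theta, since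
    \<open>elastic\<close> does too.\<close>
  have boundary: "C = l\<^sup>2 * (sin (\<theta> x))\<^sup>2 * (W\<^sup>2 / ?e x + 1)"
    if "?e x * p x = W * l * sin (\<theta> x)" "x \<in> {0..1}" for x
  proof -
    have "?e x * (p x)\<^sup>2 = (W * l * sin (\<theta> x))\<^sup>2 / ?e x"
      using e[of x] unfolding that(1)[symmetric] by (simp add: power2_eq_square)
    then show ?thesis
      using energy[OF that(2)] by (simp add: power_mult_distrib algebra_simps)
  qed
  \<comment> \<open>The summand s is strictly increasing and s / (kappa + (1 - kappa) s) is
    nondecreasing, so the value of C determines sin^2 theta at a boundary point.\<close>
  have mono: "s * (W\<^sup>2 / (\<kappa> + (1 - \<kappa>) * s) + 1) < t * (W\<^sup>2 / (\<kappa> + (1 - \<kappa>) * t) + 1)"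
    if "0 \<le> s" "s < t" for s t
  proof -
    have "\<kappa> + (1 - \<kappa>) * s > 0" "\<kappa> + (1 - \<kappa>) * t > 0"
      using pos that by (auto intro!: add_pos_nonneg)
    then have "s / (\<kappa> + (1 - \<kappa>) * s) \<le> t / (\<kappa> + (1 - \<kappa>) * t)"
      using pos that by (simp add: field_simps)
    then have "W\<^sup>2 * (s / (\<kappa> + (1 - \<kappa>) * s)) \<le> W\<^sup>2 * (t / (\<kappa> + (1 - \<kappa>) * t))"
      by (intro mult_left_mono) auto
    then show ?thesis using that by (simp add: algebra_simps)
  qed
  have "(sin (\<theta> 0))\<^sup>2 * (W\<^sup>2 / ?e 0 + 1) = (sin (\<theta> 1))\<^sup>2 * (W\<^sup>2 / ?e 1 + 1)"
    using boundary[OF bc0] boundary[OF bc1] pos by simp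
  then have "(sin (\<theta> 0))\<^sup>2 = (sin (\<theta> 1))\<^sup>2"
    unfolding elastic_eq using mono[of "(sin (\<theta> 0))\<^sup>2" "(sin (\<theta> 1))\<^sup>2"] mono[of "(sin (\<theta> 1))\<^sup>2" "(sin (\<theta> 0))\<^sup>2"]
    by (cases "(sin (\<theta> 0))\<^sup>2" "(sin (\<theta> 1))\<^sup>2" rule: linorder_cases) auto
  then have "sin (\<theta> 0) = sin (\<theta> 1)" and e_eq: "?e 0 = ?e 1"
    using sin_nonneg[of 0] sin_nonneg[of 1] by (auto simp: elastic_eq)
  then have p_eq: "p 0 = p 1"
    using bc0 bc1 e[of 1] by (metis less_irrefl mult_cancel_left)
  show ?thesis
  proof (rule ccontr)
    assume "\<not> p x > 0"
    then obtain y where "0 \<le> y" "y \<le> x" "p y = 0"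
      using IVT2'[of p x 0 0] p0 x continuous_on_subset[OF contp, of "{0..x}"] by auto
    then have y: "y \<in> {0..1}" "p y = 0" using x by auto
    have C_le: "C \<le> l\<^sup>2"
      using energy[OF y(1)] y(2) abs_sin_le_one[of "\<theta> y"] by (auto simp: abs_square_le_1 mult_left_le)
    \<comment> \<open>v is the velocity of the arc-length coordinate given by the integral of
      sqrt(e) over theta. In it the term with p^2 disappears from the equation, and since sin theta
      >= 0 the monotonicity of v is governed by the sign of cos theta.\<close>
    define v where "v x = sqrt (?e x) * p x" for x
    have contv: "continuous_on {0..1} v"
      unfolding v_def by (intro continuous_intros conte contp)
    have v_deriv: "(v has_real_derivative - (l\<^sup>2 * sin (\<theta> x) * cos (\<theta> x) / sqrt (?e x))) (at x)"
      if x: "x \<in> {0<..<1}" for x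
    proof -
      have x': "x \<in> {0..1}" using x by auto
      note d = at[OF \<theta>[OF x'] x] at[OF p[OF x'] x] DERIV_elastic[OF at[OF \<theta>[OF x'] x]]
      have s: "sqrt (?e x) > 0" "sqrt (?e x) * sqrt (?e x) = ?e x" using e[of x] by auto
      have "(v has_real_derivative
          (?e x * q x + 1/2 * (1 - \<kappa>) * sin (2 * \<theta> x) * (p x)\<^sup>2) / sqrt (?e x)) (at x)"
        unfolding v_def using s e[of x]
        by (auto intro!: derivative_eq_intros d simp: field_simps power2_eq_square)
      moreover have "?e x * q x + 1/2 * (1 - \<kappa>) * sin (2 * \<theta> x) * (p x)\<^sup>2 = - (l\<^sup>2 * sin (\<theta> x) * cos (\<theta> x))"
        using ode[OF x] by (simp add: sin_double)
      ultimately show ?thesis by simp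
    qed
    have v_ends: "v 0 = v 1" "v 0 > 0" "v y = 0"
      using p_eq e_eq p0 e[of 0] y by (auto simp: v_def)
    show False
    proof (cases "C = l\<^sup>2")
      case True
      \<comment> \<open>At the saddle level the first integral reads e p^2 = l^2 cos^2 theta. With e
        >= kappa this bounds the derivative of cos theta linearly by cos theta itself.\<close>
      have bound: "\<bar>- sin (\<theta> x) * p x\<bar> \<le> (l / sqrt \<kappa>) * \<bar>cos (\<theta> x)\<bar>" if "x \<in> {0..1}" for x
      proof -
        have "\<kappa> * (p x)\<^sup>2 \<le> ?e x * (p x)\<^sup>2"
          using pos by (intro mult_right_mono) (auto simp: elastic_eq)
        also have "\<dots> = l\<^sup>2 * (cos (\<theta> x))\<^sup>2"
          using energy[OF that] True by (simp add: cos_squared_eq algebra_simps)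
        finally have "(sqrt \<kappa> * \<bar>p x\<bar>)\<^sup>2 \<le> (l * \<bar>cos (\<theta> x)\<bar>)\<^sup>2"
          using pos by (simp add: power_mult_distrib)
        then have "sqrt \<kappa> * \<bar>p x\<bar> \<le> l * \<bar>cos (\<theta> x)\<bar>"
          by (rule power2_le_imp_le) (use pos in simp)
        then have "\<bar>p x\<bar> \<le> (l / sqrt \<kappa>) * \<bar>cos (\<theta> x)\<bar>"
          using pos by (simp add: field_simps)
        moreover have "\<bar>- sin (\<theta> x) * p x\<bar> \<le> \<bar>p x\<bar>"
          by (auto simp: abs_mult intro!: mult_left_le_one_le)
        ultimately show ?thesis by linarith
      qed
      \<comment> \<open>cos theta vanishes at y, hence at 0 by the Gronwall lemma; the first
        integral then gives p(0) = 0, against \<open>p0\<close>.\<close>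
      have "cos (\<theta> 0) = 0"
      proof (rule zero_at_left_end_if_linear_bound[OF _ bound y(1)])
        show "((\<lambda>x. cos (\<theta> x)) has_real_derivative - sin (\<theta> x) * p x) (at x within {0..1})"
          if "x \<in> {0..1}" for x
          by (auto intro!: derivative_eq_intros \<theta> that)
        have "(sin (\<theta> y))\<^sup>2 = 1" using energy[OF y(1)] y(2) True pos by simp
        then show "cos (\<theta> y) = 0" using sin_cos_squared_add[of "\<theta> y"] by simp
      qed
      then have "(sin (\<theta> 0))\<^sup>2 = 1" using sin_cos_squared_add[of "\<theta> 0"] by simp
      then have "?e 0 * (p 0)\<^sup>2 = 0" using True by (simp add: C_def)
      then show False using e[of 0] p0 by simp
    next
      case False
      \<comment> \<open>A zero of cos theta would give C >= l^2, whereas here C < l^2.\<close>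
      have cos_nz: "cos (\<theta> x) \<noteq> 0" if "x \<in> {0..1}" for x
      proof
        assume "cos (\<theta> x) = 0"
        then have "(sin (\<theta> x))\<^sup>2 = 1" using sin_cos_squared_add[of "\<theta> x"] by simp
        moreover have "?e x * (p x)\<^sup>2 \<ge> 0" using e[of x] by simp
        ultimately show False using energy[OF that] C_le False by simp
      qed
      have contc: "continuous_on {0..1} (\<lambda>x. cos (\<theta> x))" by (intro continuous_intros cont\<theta>)
      have "(\<forall>x\<in>{0..1}. cos (\<theta> x) > 0) \<or> (\<forall>x\<in>{0..1}. cos (\<theta> x) < 0)"
      proof (rule ccontr)
        assume "\<not> ?thesis"
        then obtain a b where ab: "a \<in> {0..1}" "b \<in> {0..1}" "cos (\<theta> a) \<le> 0" "cos (\<theta> b) \<ge> 0"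
          by force
        have "connected ((\<lambda>x. cos (\<theta> x)) ` {0..1})"
          using contc by (intro connected_continuous_image) auto
        then have "0 \<in> (\<lambda>x. cos (\<theta> x)) ` {0..1}"
          by (rule connectedD_interval) (use ab in auto)
        then show False using cos_nz by force
      qed
      then show False
      proof
        assume pos': "\<forall>x\<in>{0..1}. cos (\<theta> x) > 0"
        \<comment> \<open>v decreases from v(y) = 0 to v(1), which equals v(0) > 0: here the
          matching of the two ends is used.\<close>
        have "v 1 \<le> v y"
        proof (rule DERIV_nonpos_imp_decreasing_open[of y 1 v])
          show "\<exists>d. (v has_real_derivative d) (at x) \<and> d \<le> 0" if "y < x" "x < 1" for x
          proof (intro exI conjI)
            show "- (l\<^sup>2 * sin (\<theta> x) * cos (\<theta> x) / sqrt (?e x)) \<le> 0"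
              using that y pos' sin_nonneg[of x] e[of x] by (simp add: less_imp_le)
          qed (rule v_deriv, use that y in auto)
        qed (use y in \<open>auto intro!: continuous_on_subset[OF contv]\<close>)
        then show False using v_ends by simp
      next
        assume neg': "\<forall>x\<in>{0..1}. cos (\<theta> x) < 0"
        \<comment> \<open>For negative cosine v increases up to v(y) = 0, which contradicts v(0) >
          0.\<close>
        have "v 0 \<le> v y"
        proof (rule DERIV_nonneg_imp_increasing_open[of 0 y v])
          show "\<exists>d. (v has_real_derivative d) (at x) \<and> 0 \<le> d" if "0 < x" "x < y" for x
          proof (intro exI conjI)
            show "0 \<le> - (l\<^sup>2 * sin (\<theta> x) * cos (\<theta> x) / sqrt (?e x))"
              using that y neg' sin_nonneg[of x] e[of x]
              by (simp add: less_imp_le divide_nonpos_pos mult_nonneg_nonpos)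
          qed (rule v_deriv, use that y in auto)
        qed (use y in \<open>auto intro!: continuous_on_subset[OF contv]\<close>)
        then show False using v_ends by simp
      qed
    qed
  qed
qed

section \<open>The second variation\<close>

text \<open>The mean value inequality bounds the difference quotients by B; dominated convergence
  along sequences then gives the limit.\<close>

lemma has_real_derivative_integral_dominated:
  fixes f f' :: "real \<Rightarrow> 'a \<Rightarrow> real"
  assumes s0: "s0 \<in> {a<..<b}"
    and int: "\<And>s. s \<in> {a<..<b} \<Longrightarrow> integrable M (f s)"
    and der: "\<And>s x. s \<in> {a<..<b} \<Longrightarrow> x \<in> space M \<Longrightarrow> ((\<lambda>s. f s x) has_real_derivative f' s x) (at s)"
    and meas: "f' s0 \<in> borel_measurable M"
    and B: "integrable M B" "\<And>s x. s \<in> {a<..<b} \<Longrightarrow> x \<in> space M \<Longrightarrow> \<bar>f' s x\<bar> \<le> B x"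
  shows "((\<lambda>s. LINT x|M. f s x) has_real_derivative (LINT x|M. f' s0 x)) (at s0)"
proof -
  let ?S = "{a<..<b}"
  have "((\<lambda>s. ((LINT x|M. f s x) - (LINT x|M. f s0 x)) / (s - s0)) \<longlongrightarrow> (LINT x|M. f' s0 x)) (at s0 within ?S)"
    unfolding tendsto_at_iff_sequentially
  proof (intro allI impI)
    fix X :: "nat \<Rightarrow> real" assume X: "\<forall>i. X i \<in> ?S - {s0}" and lim: "X \<longlonglongrightarrow> s0"
    have conv: "(\<lambda>i. LINT x|M. (f (X i) x - f s0 x) / (X i - s0)) \<longlonglongrightarrow> (LINT x|M. f' s0 x)"
    proof (rule integral_dominated_convergence[OF meas _ B(1)])
      show "(\<lambda>x. (f (X i) x - f s0 x) / (X i - s0)) \<in> borel_measurable M" for i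
        using int[of "X i"] int[OF s0] X by auto
      have "(\<lambda>i. (f (X i) x - f s0 x) / (X i - s0)) \<longlonglongrightarrow> f' s0 x" if "x \<in> space M" for x
      proof -
        have "((\<lambda>s. (f s x - f s0 x) / (s - s0)) \<longlongrightarrow> f' s0 x) (at s0)"
          using der[OF s0 that] by (simp add: has_field_derivative_iff)
        moreover have "filterlim X (at s0) sequentially"
          using X lim by (auto simp: filterlim_at)
        ultimately show ?thesis by (rule filterlim_compose)
      qed
      then show "AE x in M. (\<lambda>i. (f (X i) x - f s0 x) / (X i - s0)) \<longlonglongrightarrow> f' s0 x"
        by (rule AE_I2)
      have "norm ((f (X i) x - f s0 x) / (X i - s0)) \<le> B x" if x: "x \<in> space M" for i x
      proof -
        have "norm (f (X i) x - f s0 x) \<le> B x * norm (X i - s0)"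
        proof (rule field_differentiable_bound[of ?S "\<lambda>s. f s x" "\<lambda>s. f' s x"])
          show "((\<lambda>s. f s x) has_real_derivative f' s x) (at s within ?S)" if "s \<in> ?S" for s
            by (rule has_field_derivative_at_within[OF der[OF that x]])
        qed (use X s0 B(2) x in auto)
        then show ?thesis using X by (simp add: divide_le_eq)
      qed
      then show "AE x in M. norm ((f (X i) x - f s0 x) / (X i - s0)) \<le> B x" for i
        by (intro AE_I2)
    qed
    have eq: "(LINT x|M. (f (X i) x - f s0 x) / (X i - s0))
        = ((LINT x|M. f (X i) x) - (LINT x|M. f s0 x)) / (X i - s0)" for i
      using X int[of "X i"] int[OF s0] by (simp add: Bochner_Integration.integral_diff)
    show "((\<lambda>s. ((LINT x|M. f s x) - (LINT x|M. f s0 x)) / (s - s0)) \<circ> X) \<longlonglongrightarrow> (LINT x|M. f' s0 x)"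
      using conv unfolding eq o_def .
  qed
  then show ?thesis
    using s0 at_within_open[of s0 ?S] by (simp add: has_field_derivative_iff)
qed

lemma elastic_abs_le:
  assumes "0 < \<kappa>" "\<kappa> < 1"
  shows "\<bar>elastic \<kappa> t\<bar> \<le> 1"
proof -
  have "elastic \<kappa> t \<le> (sin t)\<^sup>2 + 1 * (cos t)\<^sup>2"
    unfolding elastic_def using assms by (intro add_left_mono mult_right_mono) auto
  then show ?thesis using elastic_pos[OF assms, of t] by simp
qed

section \<open>Two derivatives of the bulk energy along theta + s v\<close>

context
  fixes \<kappa> l :: real and \<theta> p v g :: "real \<Rightarrow> real"
  assumes \<kappa>: "0 < \<kappa>" "\<kappa> < 1"
    and cont: "continuous_on {0..1} \<theta>" "continuous_on {0..1} p" "continuous_on {0..1} v"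
    and g: "g \<in> L2"
begin

text \<open>The integrand of the bulk energy on the line, with g in the role of v'; nothing in this
  context ties g to v. \<open>G1\<close> and \<open>G2\<close> are its first and second derivatives
  in s.\<close>

private definition "G s x = 1/2 * (elastic \<kappa> (\<theta> x + s * v x) * (p x + s * g x)\<^sup>2)
  + 1/2 * l\<^sup>2 * (cos (\<theta> x + s * v x))\<^sup>2"

private definition "G1 s x = 1/2 * (1 - \<kappa>) * sin (2 * (\<theta> x + s * v x)) * v x * (p x + s * g x)\<^sup>2
  + elastic \<kappa> (\<theta> x + s * v x) * ((p x + s * g x) * g x)
  - 1/2 * l\<^sup>2 * sin (2 * (\<theta> x + s * v x)) * v x"

private definition "G2 s x = (1 - \<kappa>) * cos (2 * (\<theta> x + s * v x)) * (v x)\<^sup>2 * (p x + s * g x)\<^sup>2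
  + 2 * (1 - \<kappa>) * sin (2 * (\<theta> x + s * v x)) * v x * ((p x + s * g x) * g x)
  + elastic \<kappa> (\<theta> x + s * v x) * (g x)\<^sup>2
  - l\<^sup>2 * cos (2 * (\<theta> x + s * v x)) * (v x)\<^sup>2"

private lemma cont_coeff: "continuous_on {0..1} (\<lambda>x. elastic \<kappa> (\<theta> x + s * v x))"
  unfolding elastic_def by (intro continuous_intros cont)

private lemma P_L2: "(\<lambda>x. p x + s * g x) \<in> L2"
  by (rule L2_add[OF continuous_mem_L2[OF cont(2)] g])

private lemma integrable_P_square: "integrable unit_measure (\<lambda>x. (p x + s * g x)\<^sup>2)"
  by (rule L2_square_integrable[OF P_L2])

private lemma integrable_P_g: "integrable unit_measure (\<lambda>x. (p x + s * g x) * g x)"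
  by (rule L2_mult_integrable[OF P_L2 g])

private lemma integrable_G_terms:
  "integrable unit_measure (\<lambda>x. elastic \<kappa> (\<theta> x + s * v x) * (p x + s * g x)\<^sup>2)"
  "integrable unit_measure (\<lambda>x. (cos (\<theta> x + s * v x))\<^sup>2)"
proof -
  show "integrable unit_measure (\<lambda>x. elastic \<kappa> (\<theta> x + s * v x) * (p x + s * g x)\<^sup>2)"
    by (rule continuous_mult_integrable_unit[OF integrable_P_square cont_coeff])
  show "integrable unit_measure (\<lambda>x. (cos (\<theta> x + s * v x))\<^sup>2)"
    by (rule continuous_integrable_unit) (intro continuous_intros cont)
qed

private lemma integrable_G: "integrable unit_measure (G s)"
  unfolding G_def[abs_def]
  by (rule Bochner_Integration.integrable_add; rule integrable_mult_right; rule integrable_G_terms)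

private lemma integrable_G1: "integrable unit_measure (G1 s)"
  unfolding G1_def[abs_def]
proof (rule Bochner_Integration.integrable_diff, rule Bochner_Integration.integrable_add)
  show "integrable unit_measure (\<lambda>x. 1/2 * (1 - \<kappa>) * sin (2 * (\<theta> x + s * v x)) * v x * (p x + s * g x)\<^sup>2)"
    by (rule continuous_mult_integrable_unit[OF integrable_P_square]) (intro continuous_intros cont)
  show "integrable unit_measure (\<lambda>x. elastic \<kappa> (\<theta> x + s * v x) * ((p x + s * g x) * g x))"
    by (rule continuous_mult_integrable_unit[OF integrable_P_g cont_coeff])
  show "integrable unit_measure (\<lambda>x. 1/2 * l\<^sup>2 * sin (2 * (\<theta> x + s * v x)) * v x)"
    by (rule continuous_integrable_unit) (intro continuous_intros cont)
qed

private lemma integrable_G2: "integrable unit_measure (G2 s)"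
  unfolding G2_def[abs_def]
proof (rule Bochner_Integration.integrable_diff, rule Bochner_Integration.integrable_add,
    rule Bochner_Integration.integrable_add)
  show "integrable unit_measure (\<lambda>x. (1 - \<kappa>) * cos (2 * (\<theta> x + s * v x)) * (v x)\<^sup>2 * (p x + s * g x)\<^sup>2)"
    by (rule continuous_mult_integrable_unit[OF integrable_P_square]) (intro continuous_intros cont)
  show "integrable unit_measure (\<lambda>x. 2 * (1 - \<kappa>) * sin (2 * (\<theta> x + s * v x)) * v x * ((p x + s * g x) * g x))"
    by (rule continuous_mult_integrable_unit[OF integrable_P_g]) (intro continuous_intros cont)
  show "integrable unit_measure (\<lambda>x. elastic \<kappa> (\<theta> x + s * v x) * (g x)\<^sup>2)"
    by (rule continuous_mult_integrable_unit[OF L2_square_integrable[OF g] cont_coeff])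
  show "integrable unit_measure (\<lambda>x. l\<^sup>2 * cos (2 * (\<theta> x + s * v x)) * (v x)\<^sup>2)"
    by (rule continuous_integrable_unit) (intro continuous_intros cont)
qed

private lemma DERIV_elastic_line:
  "((\<lambda>s. elastic \<kappa> (\<theta> x + s * v x)) has_real_derivative (1 - \<kappa>) * sin (2 * (\<theta> x + s * v x)) * v x) (at s)"
  by (rule DERIV_elastic) (auto intro!: derivative_eq_intros)

private lemma DERIV_square_line:
  "((\<lambda>s. (p x + s * g x)\<^sup>2) has_real_derivative 2 * ((p x + s * g x) * g x)) (at s)"
  by (auto intro!: derivative_eq_intros)

private lemma DERIV_G: "((\<lambda>s. G s x) has_real_derivative G1 s x) (at s)"
proof -
  have "((\<lambda>s. (cos (\<theta> x + s * v x))\<^sup>2) has_real_derivative - (sin (2 * (\<theta> x + s * v x)) * v x)) (at s)"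
    unfolding sin_double by (auto intro!: derivative_eq_intros)
  note d = DERIV_add[OF DERIV_cmult[where c = "1/2", OF DERIV_mult[OF DERIV_elastic_line DERIV_square_line]]
      DERIV_cmult[where c = "1/2 * l\<^sup>2", OF this]]
  show ?thesis
    unfolding G_def by (rule DERIV_cong[OF d]) (simp add: G1_def field_simps)
qed

private lemma DERIV_G1: "((\<lambda>s. G1 s x) has_real_derivative G2 s x) (at s)"
proof -
  have d1: "((\<lambda>s. c * sin (2 * (\<theta> x + s * v x)) * v x) has_real_derivative
      c * (2 * cos (2 * (\<theta> x + s * v x)) * v x) * v x) (at s)" for c
    by (auto intro!: derivative_eq_intros)
  have d2: "((\<lambda>s. (p x + s * g x) * g x) has_real_derivative g x * g x) (at s)"
    by (auto intro!: derivative_eq_intros)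
  note d = DERIV_diff[OF DERIV_add[OF DERIV_mult[OF d1 DERIV_square_line] DERIV_mult[OF DERIV_elastic_line d2]] d1]
  show ?thesis
    unfolding G1_def by (rule DERIV_cong[OF d]) (simp add: G2_def field_simps power2_eq_square)
qed

text \<open>v enters through products such as v^2 (p + s g)^2. They have an integrable majorant,
  uniform in |s| < 1, because v is bounded; square integrability of v alone would not give
  one.\<close>

private lemma domination:
  obtains B where "integrable unit_measure B"
    "\<And>s x. s \<in> {-1<..<1} \<Longrightarrow> x \<in> space unit_measure \<Longrightarrow> \<bar>G1 s x\<bar> \<le> B x"
    "\<And>s x. s \<in> {-1<..<1} \<Longrightarrow> x \<in> space unit_measure \<Longrightarrow> \<bar>G2 s x\<bar> \<le> B x"
proof -
  obtain K where K: "K > 0" "\<And>x. x \<in> {0..1} \<Longrightarrow> \<bar>v x\<bar> \<le> K"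
    by (rule continuous_unit_bounded[OF cont(3)]) blast
  define P where "P x = 2 * (p x)\<^sup>2 + 2 * (g x)\<^sup>2" for x
  define B1 where "B1 x = K * P x + (P x + (g x)\<^sup>2) + l\<^sup>2 * K" for x
  define B2 where "B2 x = K\<^sup>2 * P x + 2 * K * (P x + (g x)\<^sup>2) + (g x)\<^sup>2 + l\<^sup>2 * K\<^sup>2" for x
  have P: "integrable unit_measure P" unfolding P_def
    by (intro Bochner_Integration.integrable_add integrable_mult_right
        L2_square_integrable[OF g] L2_square_integrable[OF continuous_mem_L2[OF cont(2)]])
  have pt: "\<bar>G1 s x\<bar> \<le> B1 x \<and> \<bar>G2 s x\<bar> \<le> B2 x" if s: "s \<in> {-1<..<1}" and x: "x \<in> space unit_measure" for s x
  proof -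
    define u where "u = \<theta> x + s * v x"
    define R where "R = p x + s * g x"
    have s2: "s\<^sup>2 \<le> 1" using s by (auto simp: abs_square_le_1)
    have "R\<^sup>2 \<le> 2 * (p x)\<^sup>2 + 2 * (s * g x)\<^sup>2"
      using sum_squares_bound[of "p x" "s * g x"] by (simp add: R_def power2_sum)
    also have "(s * g x)\<^sup>2 \<le> 1 * (g x)\<^sup>2"
      unfolding power_mult_distrib using s2 by (intro mult_right_mono) auto
    finally have R2: "R\<^sup>2 \<le> P x" by (simp add: P_def)
    have "2 * \<bar>R\<bar> * \<bar>g x\<bar> \<le> R\<^sup>2 + (g x)\<^sup>2"
      using sum_squares_bound[of "\<bar>R\<bar>" "\<bar>g x\<bar>"] by simp
    then have Rg: "\<bar>R * g x\<bar> \<le> P x + (g x)\<^sup>2"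
      using R2 mult_nonneg_nonneg[of "\<bar>R\<bar>" "\<bar>g x\<bar>"] unfolding abs_mult by linarith
    have v: "\<bar>v x\<bar> \<le> K" using K(2)[of x] x by auto
    then have v2: "(v x)\<^sup>2 \<le> K\<^sup>2" using K(1) by (simp add: abs_le_square_iff[symmetric])
    have le: "\<bar>c * y\<bar> \<le> b" if "\<bar>c\<bar> \<le> 1" "\<bar>y\<bar> \<le> b" for c y b :: real
      using mult_mono[OF that] by (simp add: abs_mult)
    have trig: "\<bar>(1 - \<kappa>) * sin t\<bar> \<le> 1" "\<bar>(1 - \<kappa>) * cos t\<bar> \<le> 1" "\<bar>1/2 * (1 - \<kappa>) * sin t\<bar> \<le> 1"
      "\<bar>1/2 * sin t\<bar> \<le> 1" for t
      using \<kappa> by (intro le abs_sin_le_one abs_cos_le_one; simp add: abs_le_iff)+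
    have a: "\<bar>v x * R\<^sup>2\<bar> \<le> K * P x" "\<bar>(v x)\<^sup>2 * R\<^sup>2\<bar> \<le> K\<^sup>2 * P x" "\<bar>v x * (R * g x)\<bar> \<le> K * (P x + (g x)\<^sup>2)"
      "\<bar>l\<^sup>2 * v x\<bar> \<le> l\<^sup>2 * K" "\<bar>l\<^sup>2 * (v x)\<^sup>2\<bar> \<le> l\<^sup>2 * K\<^sup>2"
      using v v2 R2 Rg K(1) unfolding abs_mult by (auto intro!: mult_mono)
    have "G1 s x = (1/2 * (1 - \<kappa>) * sin (2 * u)) * (v x * R\<^sup>2) + elastic \<kappa> u * (R * g x)
        - (1/2 * sin (2 * u)) * (l\<^sup>2 * v x)"
      by (simp add: G1_def u_def[symmetric] R_def[symmetric] algebra_simps)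
    moreover have "\<bar>(1/2 * (1 - \<kappa>) * sin (2 * u)) * (v x * R\<^sup>2)\<bar> \<le> K * P x"
      by (intro le trig a)
    moreover have "\<bar>elastic \<kappa> u * (R * g x)\<bar> \<le> P x + (g x)\<^sup>2"
      by (intro le elastic_abs_le \<kappa> Rg)
    moreover have "\<bar>(1/2 * sin (2 * u)) * (l\<^sup>2 * v x)\<bar> \<le> l\<^sup>2 * K"
      by (intro le trig a)
    ultimately have 1: "\<bar>G1 s x\<bar> \<le> B1 x" unfolding B1_def by linarith
    have "G2 s x = ((1 - \<kappa>) * cos (2 * u)) * ((v x)\<^sup>2 * R\<^sup>2) + 2 * (((1 - \<kappa>) * sin (2 * u)) * (v x * (R * g x)))
        + elastic \<kappa> u * (g x)\<^sup>2 - cos (2 * u) * (l\<^sup>2 * (v x)\<^sup>2)"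
      by (simp add: G2_def u_def[symmetric] R_def[symmetric] algebra_simps)
    moreover have "\<bar>((1 - \<kappa>) * cos (2 * u)) * ((v x)\<^sup>2 * R\<^sup>2)\<bar> \<le> K\<^sup>2 * P x"
      by (intro le trig a)
    moreover have "\<bar>((1 - \<kappa>) * sin (2 * u)) * (v x * (R * g x))\<bar> \<le> K * (P x + (g x)\<^sup>2)"
      by (intro le trig a)
    moreover have "\<bar>elastic \<kappa> u * (g x)\<^sup>2\<bar> \<le> (g x)\<^sup>2"
      by (intro le elastic_abs_le \<kappa>) simp
    moreover have "\<bar>cos (2 * u) * (l\<^sup>2 * (v x)\<^sup>2)\<bar> \<le> l\<^sup>2 * K\<^sup>2"
      by (intro le abs_cos_le_one a)
    ultimately have 2: "\<bar>G2 s x\<bar> \<le> B2 x" unfolding B2_def by linarith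
    show ?thesis using 1 2 by blast
  qed
  show ?thesis
  proof (rule that[of "\<lambda>x. \<bar>B1 x\<bar> + \<bar>B2 x\<bar>"])
    show "integrable unit_measure (\<lambda>x. \<bar>B1 x\<bar> + \<bar>B2 x\<bar>)"
      unfolding B1_def B2_def
      by (intro Bochner_Integration.integrable_add integrable_abs integrable_mult_right
          L2_square_integrable[OF g] P const_integrable_unit)
    show "\<bar>G1 s x\<bar> \<le> \<bar>B1 x\<bar> + \<bar>B2 x\<bar>" "\<bar>G2 s x\<bar> \<le> \<bar>B1 x\<bar> + \<bar>B2 x\<bar>"
      if "s \<in> {-1<..<1}" "x \<in> space unit_measure" for s x
      using pt[OF that] by linarith+
  qed
qed

lemma second_derivative_bulk_energy:
  assumes F: "\<And>s. F s = 1/2 * (LINT x|unit_measure. elastic \<kappa> (\<theta> x + s * v x) * (p x + s * g x)\<^sup>2)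
    + 1/2 * l\<^sup>2 * (LINT x|unit_measure. (cos (\<theta> x + s * v x))\<^sup>2) + c"
  shows "deriv (deriv F) 0 = (LINT x|unit_measure.
      ((1 - \<kappa>) * cos (2 * \<theta> x) * (p x)\<^sup>2 - l\<^sup>2 * cos (2 * \<theta> x)) * (v x * v x)
      + 2 * ((1 - \<kappa>) * sin (2 * \<theta> x) * p x) * (v x * g x)
      + elastic \<kappa> (\<theta> x) * (g x * g x))"
proof -
  have F_eq: "F s = (LINT x|unit_measure. G s x) + c" for s
    unfolding F G_def using integrable_G_terms[of s] by (simp add: Bochner_Integration.integral_add)
  obtain B where B: "integrable unit_measure B"
    "\<And>s x. s \<in> {-1<..<1} \<Longrightarrow> x \<in> space unit_measure \<Longrightarrow> \<bar>G1 s x\<bar> \<le> B x"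
    "\<And>s x. s \<in> {-1<..<1} \<Longrightarrow> x \<in> space unit_measure \<Longrightarrow> \<bar>G2 s x\<bar> \<le> B x"
    by (rule domination) blast
  have "((\<lambda>s. LINT x|unit_measure. G s x) has_real_derivative (LINT x|unit_measure. G1 s x)) (at s)"
    if "s \<in> {-1<..<1}" for s
    by (rule has_real_derivative_integral_dominated[OF that integrable_G DERIV_G
          borel_measurable_integrable[OF integrable_G1] B(1,2)])
  then have "(F has_real_derivative (LINT x|unit_measure. G1 s x)) (at s)" if "s \<in> {-1<..<1}" for s
    unfolding F_eq[abs_def] using that by (auto intro!: derivative_eq_intros)
  then have deriv_F: "(LINT x|unit_measure. G1 s x) = deriv F s" if "s \<in> {-1<..<1}" for s
    using that by (metis DERIV_imp_deriv)
  have "((\<lambda>s. LINT x|unit_measure. G1 s x) has_real_derivative (LINT x|unit_measure. G2 0 x)) (at 0)"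
    by (rule has_real_derivative_integral_dominated[OF _ integrable_G1 DERIV_G1
          borel_measurable_integrable[OF integrable_G2] B(1,3)]) auto
  then have "(deriv F has_real_derivative (LINT x|unit_measure. G2 0 x)) (at 0)"
    by (rule has_field_derivative_transform_within_open[of _ _ _ "{-1<..<1}"]) (auto simp: deriv_F)
  then have "deriv (deriv F) 0 = (LINT x|unit_measure. G2 0 x)"
    by (rule DERIV_imp_deriv)
  also have "G2 0 = (\<lambda>x. ((1 - \<kappa>) * cos (2 * \<theta> x) * (p x)\<^sup>2 - l\<^sup>2 * cos (2 * \<theta> x)) * (v x * v x)
      + 2 * ((1 - \<kappa>) * sin (2 * \<theta> x) * p x) * (v x * g x)
      + elastic \<kappa> (\<theta> x) * (g x * g x))"
    by (simp add: G2_def fun_eq_iff power2_eq_square algebra_simps)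
  finally show ?thesis .
qed

end

section \<open>Quadratic integrals under L2 limits\<close>

lemma LINT_mult_tendsto_0:
  assumes "\<And>n. a n \<in> L2" "\<And>n. b n \<in> L2"
    and "(\<lambda>n. LINT x|unit_measure. (a n x)\<^sup>2) \<longlonglongrightarrow> A" "(\<lambda>n. LINT x|unit_measure. (b n x)\<^sup>2) \<longlonglongrightarrow> 0"
  shows "(\<lambda>n. LINT x|unit_measure. a n x * b n x) \<longlonglongrightarrow> 0"
proof -
  have lim: "(\<lambda>n. (LINT x|unit_measure. (a n x)\<^sup>2) * (LINT x|unit_measure. (b n x)\<^sup>2)) \<longlonglongrightarrow> 0"
    using tendsto_mult[OF assms(3,4)] by simp
  have "(\<lambda>n. (LINT x|unit_measure. a n x * b n x)\<^sup>2) \<longlonglongrightarrow> 0"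
    by (rule tendsto_sandwich[OF _ _ tendsto_const lim])
      (use Cauchy_Schwarz_unit[OF assms(1,2)] in auto)
  then show ?thesis
    using tendsto_real_sqrt[of "\<lambda>n. (LINT x|unit_measure. a n x * b n x)\<^sup>2" 0 sequentially]
    by (simp add: tendsto_rabs_zero_iff)
qed

text \<open>Expanding around the limit, fn hn = f h - h (f - fn) - f (h - hn) + (f - fn)(h - hn).
  Every correction contains a factor tending to 0 in L2.\<close>

lemma LINT_mult_tendsto:
  assumes L2: "f \<in> L2" "h \<in> L2" "\<And>n. fn n \<in> L2" "\<And>n. hn n \<in> L2" and c: "continuous_on {0..1} c"
    and f: "(\<lambda>n. LINT x|unit_measure. (f x - fn n x)\<^sup>2) \<longlonglongrightarrow> 0"
    and h: "(\<lambda>n. LINT x|unit_measure. (h x - hn n x)\<^sup>2) \<longlonglongrightarrow> 0"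
  shows "(\<lambda>n. LINT x|unit_measure. c x * (fn n x * hn n x)) \<longlonglongrightarrow> (LINT x|unit_measure. c x * (f x * h x))"
proof -
  have cL2: "(\<lambda>x. c x * u x) \<in> L2" if "u \<in> L2" for u
  proof -
    have "integrable unit_measure (\<lambda>x. (c x)\<^sup>2 * (u x)\<^sup>2)"
      by (rule continuous_mult_integrable_unit[OF L2_square_integrable[OF that]]) (intro continuous_intros c)
    then show ?thesis
      using L2_measurable[OF that] borel_measurable_unit[OF c]
      unfolding L2_def by (simp add: power_mult_distrib)
  qed
  have df: "(\<lambda>x. f x - fn n x) \<in> L2" and dh: "(\<lambda>x. h x - hn n x) \<in> L2" for n
    using L2_add[OF L2(1) L2(3), of "-1"] L2_add[OF L2(2) L2(4), of "-1"] by simp_all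
  have "(\<lambda>n. LINT x|unit_measure. (c x * h x) * (f x - fn n x)) \<longlonglongrightarrow> 0"
    by (rule LINT_mult_tendsto_0[OF cL2[OF L2(2)] df tendsto_const f])
  moreover have "(\<lambda>n. LINT x|unit_measure. (c x * f x) * (h x - hn n x)) \<longlonglongrightarrow> 0"
    by (rule LINT_mult_tendsto_0[OF cL2[OF L2(1)] dh tendsto_const h])
  moreover have "(\<lambda>n. LINT x|unit_measure. (c x * (f x - fn n x)) * (h x - hn n x)) \<longlonglongrightarrow> 0"
  proof (rule LINT_mult_tendsto_0[OF cL2[OF df] dh _ h])
    obtain K where K: "K > 0" "\<And>x. x \<in> {0..1} \<Longrightarrow> \<bar>c x\<bar> \<le> K"
      by (rule continuous_unit_bounded[OF c]) blast
    have le: "(LINT x|unit_measure. (c x * (f x - fn n x))\<^sup>2) \<le> K\<^sup>2 * (LINT x|unit_measure. (f x - fn n x)\<^sup>2)" for n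
    proof -
      have "(LINT x|unit_measure. (c x * (f x - fn n x))\<^sup>2) \<le> (LINT x|unit_measure. K\<^sup>2 * (f x - fn n x)\<^sup>2)"
      proof (rule integral_mono[OF L2_square_integrable[OF cL2[OF df]] integrable_mult_right[OF L2_square_integrable[OF df]]])
        fix x assume "x \<in> space unit_measure"
        then have "\<bar>c x\<bar> \<le> \<bar>K\<bar>" using K(2)[of x] by auto
        then show "(c x * (f x - fn n x))\<^sup>2 \<le> K\<^sup>2 * (f x - fn n x)\<^sup>2"
          unfolding power_mult_distrib by (intro mult_right_mono) (auto simp: abs_le_square_iff)
      qed
      then show ?thesis by simp
    qed
    have lim: "(\<lambda>n. K\<^sup>2 * (LINT x|unit_measure. (f x - fn n x)\<^sup>2)) \<longlonglongrightarrow> 0"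
      using tendsto_mult[OF tendsto_const f] by simp
    show "(\<lambda>n. LINT x|unit_measure. (c x * (f x - fn n x))\<^sup>2) \<longlonglongrightarrow> 0"
      by (rule tendsto_sandwich[OF _ _ tendsto_const lim]) (use le in auto)
  qed
  ultimately have lim: "(\<lambda>n. (LINT x|unit_measure. c x * (f x * h x))
      - (LINT x|unit_measure. (c x * h x) * (f x - fn n x))
      - (LINT x|unit_measure. (c x * f x) * (h x - hn n x))
      + (LINT x|unit_measure. (c x * (f x - fn n x)) * (h x - hn n x)))
      \<longlonglongrightarrow> (LINT x|unit_measure. c x * (f x * h x)) - 0 - 0 + 0"
    by (intro tendsto_intros)
  have "(LINT x|unit_measure. c x * (f x * h x))
      - (LINT x|unit_measure. (c x * h x) * (f x - fn n x))
      - (LINT x|unit_measure. (c x * f x) * (h x - hn n x))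
      + (LINT x|unit_measure. (c x * (f x - fn n x)) * (h x - hn n x))
    = (LINT x|unit_measure. c x * (fn n x * hn n x))" for n
  proof -
    have i0: "integrable unit_measure (\<lambda>x. c x * (f x * h x))"
      using L2_mult_integrable[OF cL2[OF L2(1)] L2(2)] by (simp add: mult.assoc)
    note i = i0 L2_mult_integrable[OF cL2[OF L2(2)] df, of n] L2_mult_integrable[OF cL2[OF L2(1)] dh, of n]
      L2_mult_integrable[OF cL2[OF df] dh, of n n]
    have "(\<lambda>x. c x * (fn n x * hn n x)) = (\<lambda>x. c x * (f x * h x) - (c x * h x) * (f x - fn n x)
      - (c x * f x) * (h x - hn n x) + (c x * (f x - fn n x)) * (h x - hn n x))"
      by (auto simp: algebra_simps)
    then show ?thesis
      by (simp only: Bochner_Integration.integral_add Bochner_Integration.integral_diff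
          Bochner_Integration.integrable_diff i)
  qed
  then show ?thesis using lim by simp
qed

section \<open>Nonnegativity of the second variation by a Jacobi field\<close>

context
  fixes l \<kappa> :: real and \<theta> p q :: "real \<Rightarrow> real"
  assumes \<kappa>: "0 < \<kappa>" "\<kappa> < 1"
    and \<theta>: "\<And>x. x \<in> {0..1} \<Longrightarrow> (\<theta> has_real_derivative p x) (at x within {0..1})"
    and p: "\<And>x. x \<in> {0..1} \<Longrightarrow> (p has_real_derivative q x) (at x within {0..1})"
    and contq: "continuous_on {0..1} q"
    and ode: "\<And>x. x \<in> {0<..<1} \<Longrightarrow> elastic \<kappa> (\<theta> x) * q x
        + 1/2 * (1 - \<kappa>) * sin (2 * \<theta> x) * (p x)\<^sup>2 + 1/2 * l\<^sup>2 * sin (2 * \<theta> x) = 0"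
    and p_pos: "\<And>x. x \<in> {0..1} \<Longrightarrow> p x > 0"
begin

private lemma cont: "continuous_on {0..1} \<theta>" "continuous_on {0..1} p"
  "continuous_on {0..1} (\<lambda>x. elastic \<kappa> (\<theta> x))"
proof -
  show t: "continuous_on {0..1} \<theta>" using \<theta> by (rule DERIV_continuous_on)
  show "continuous_on {0..1} p" using p by (rule DERIV_continuous_on)
  show "continuous_on {0..1} (\<lambda>x. elastic \<kappa> (\<theta> x))"
    unfolding elastic_def by (intro continuous_intros t)
qed

text \<open>The derivative \<open>p\<close> of the solution is a positive Jacobi field. Hence the integrand is
  \<open>e (\<eta>' - (q / p) \<eta>)\<^sup>2\<close> up to the derivative of \<open>R \<eta>\<^sup>2\<close>, which integrates to zero.\<close>

lemma second_variation_test_function_nonneg: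
  assumes \<eta>: "\<eta> \<in> test_functions"
  shows "0 \<le> (LINT x|unit_measure.
      ((1 - \<kappa>) * cos (2 * \<theta> x) * (p x)\<^sup>2 - l\<^sup>2 * cos (2 * \<theta> x)) * (\<eta> x * \<eta> x)
      + 2 * ((1 - \<kappa>) * sin (2 * \<theta> x) * p x) * (\<eta> x * deriv \<eta> x)
      + elastic \<kappa> (\<theta> x) * (deriv \<eta> x * deriv \<eta> x))"
proof -
  \<comment> \<open>R is b + e q / p, where 2 b is the coefficient of the mixed term, with e q
    eliminated by the equation. In this form R is differentiable without a derivative of q, of which
    only continuity is assumed.\<close>
  define R where "R x = 1/2 * (1 - \<kappa>) * sin (2 * \<theta> x) * p x - 1/2 * l\<^sup>2 * sin (2 * \<theta> x) / p x" for x
  define R' where "R' x = (1 - \<kappa>) * cos (2 * \<theta> x) * (p x)\<^sup>2 + 1/2 * (1 - \<kappa>) * sin (2 * \<theta> x) * q x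
    - l\<^sup>2 * cos (2 * \<theta> x) + 1/2 * l\<^sup>2 * sin (2 * \<theta> x) * q x / (p x)\<^sup>2" for x
  note c\<eta> = continuous_on_test_function[OF \<eta>]
  have p_nz: "\<forall>x\<in>{0..1}. p x \<noteq> 0" "\<forall>x\<in>{0..1}. (p x)\<^sup>2 \<noteq> 0" using p_pos by fastforce+
  have R: "(R has_real_derivative R' x) (at x within {0..1})" if x: "x \<in> {0..1}" for x
    unfolding R_def R'_def using p_pos[OF x]
    by (auto intro!: derivative_eq_intros \<theta>[OF x] p[OF x] simp: field_simps power2_eq_square)
  have D: "((\<lambda>x. R x * (\<eta> x)\<^sup>2) has_real_derivative R' x * (\<eta> x)\<^sup>2 + 2 * R x * (\<eta> x * deriv \<eta> x)) (at x within {0..1})"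
    if "x \<in> {0..1}" for x
    using R[OF that] has_field_derivative_at_within[OF test_function_derivative[OF \<eta>]]
    by (auto intro!: derivative_eq_intros)
  have cR: "continuous_on {0..1} R" using R by (rule DERIV_continuous_on)
  have cR': "continuous_on {0..1} R'"
    unfolding R'_def by (intro continuous_intros cont contq p_nz)
  have c: "continuous_on {0..1} (\<lambda>x. R' x * (\<eta> x)\<^sup>2 + 2 * R x * (\<eta> x * deriv \<eta> x))"
    by (intro continuous_intros cR cR' c\<eta>)
  have "0 = R 1 * (\<eta> 1)\<^sup>2 - R 0 * (\<eta> 0)\<^sup>2"
    using test_function_boundary[OF \<eta>] by simp
  also have "\<dots> = (LINT x|unit_measure. R' x * (\<eta> x)\<^sup>2 + 2 * R x * (\<eta> x * deriv \<eta> x))"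
    by (rule LINT_derivative_unit[OF D c, symmetric])
  also have "\<dots> \<le> (LINT x|unit_measure.
      ((1 - \<kappa>) * cos (2 * \<theta> x) * (p x)\<^sup>2 - l\<^sup>2 * cos (2 * \<theta> x)) * (\<eta> x * \<eta> x)
      + 2 * ((1 - \<kappa>) * sin (2 * \<theta> x) * p x) * (\<eta> x * deriv \<eta> x)
      + elastic \<kappa> (\<theta> x) * (deriv \<eta> x * deriv \<eta> x))" (is "_ \<le> integral\<^sup>L _ ?Q")
  proof (rule integral_mono[OF continuous_integrable_unit[OF c] continuous_integrable_unit])
    show "continuous_on {0..1} ?Q"
      by (intro continuous_intros cont c\<eta>)
    fix x assume "x \<in> space unit_measure"
    then have x: "x \<in> {0<..<1}" "p x \<noteq> 0" using p_pos[of x] by auto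
    let ?e = "elastic \<kappa> (\<theta> x)" and ?S = "sin (2 * \<theta> x)"
    have eq: "?e * q x = - (1/2 * (1 - \<kappa>) * ?S * (p x)\<^sup>2 + 1/2 * l\<^sup>2 * ?S)"
      using ode[OF x(1)] by linarith
    have B: "(1 - \<kappa>) * ?S * p x - R x = - (?e * q x) / p x"
      unfolding eq R_def using x(2) by (simp add: field_simps power2_eq_square)
    have "(1 - \<kappa>) * cos (2 * \<theta> x) * (p x)\<^sup>2 - l\<^sup>2 * cos (2 * \<theta> x) - R' x
        = - (1/2 * (1 - \<kappa>) * ?S * (p x)\<^sup>2 + 1/2 * l\<^sup>2 * ?S) * q x / (p x)\<^sup>2"
      unfolding R'_def using x(2) by (simp add: field_simps)
    \<comment> \<open>The Riccati equation for w = q / p: with a the coefficient of the zeroth-order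
      term, it reads R' = a - e w^2. With B, that is R = b + e w, it makes the remaining integrand a
      perfect square.\<close>
    then have A: "(1 - \<kappa>) * cos (2 * \<theta> x) * (p x)\<^sup>2 - l\<^sup>2 * cos (2 * \<theta> x) - R' x = ?e * (q x / p x)\<^sup>2"
      unfolding eq[symmetric] by (simp add: power2_eq_square)
    have "?Q x - (R' x * (\<eta> x)\<^sup>2 + 2 * R x * (\<eta> x * deriv \<eta> x))
      = ((1 - \<kappa>) * cos (2 * \<theta> x) * (p x)\<^sup>2 - l\<^sup>2 * cos (2 * \<theta> x) - R' x) * (\<eta> x)\<^sup>2
        + 2 * ((1 - \<kappa>) * ?S * p x - R x) * (\<eta> x * deriv \<eta> x) + ?e * (deriv \<eta> x)\<^sup>2"
      by (simp add: power2_eq_square algebra_simps)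
    also have "\<dots> = ?e * (deriv \<eta> x - q x / p x * \<eta> x)\<^sup>2"
      unfolding A B by (simp add: power2_eq_square algebra_simps)
    also have "\<dots> \<ge> 0"
      using elastic_pos[OF \<kappa>, of "\<theta> x"] by simp
    finally show "R' x * (\<eta> x)\<^sup>2 + 2 * R x * (\<eta> x * deriv \<eta> x) \<le> ?Q x" by simp
  qed
  finally show ?thesis .
qed

text \<open>The coefficients are continuous on the closed interval, so the quadratic form is
  continuous under L2 convergence of the pairs (eta n, eta n') to (v, g), and nonnegativity survives
  the limit.\<close>

lemma second_variation_nonneg:
  assumes "v \<in> L2" "g \<in> L2" and \<eta>: "\<And>n. \<eta> n \<in> test_functions"
    and "(\<lambda>n. LINT x|unit_measure. (v x - \<eta> n x)\<^sup>2) \<longlonglongrightarrow> 0"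
    and "(\<lambda>n. LINT x|unit_measure. (g x - deriv (\<eta> n) x)\<^sup>2) \<longlonglongrightarrow> 0"
  shows "0 \<le> (LINT x|unit_measure.
      ((1 - \<kappa>) * cos (2 * \<theta> x) * (p x)\<^sup>2 - l\<^sup>2 * cos (2 * \<theta> x)) * (v x * v x)
      + 2 * ((1 - \<kappa>) * sin (2 * \<theta> x) * p x) * (v x * g x)
      + elastic \<kappa> (\<theta> x) * (g x * g x))"
proof -
  define A where "A x = (1 - \<kappa>) * cos (2 * \<theta> x) * (p x)\<^sup>2 - l\<^sup>2 * cos (2 * \<theta> x)" for x
  define B where "B x = 2 * ((1 - \<kappa>) * sin (2 * \<theta> x) * p x)" for x
  define e where "e x = elastic \<kappa> (\<theta> x)" for x
  have cA: "continuous_on {0..1} A" and cB: "continuous_on {0..1} B" and ce: "continuous_on {0..1} e"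
    unfolding A_def B_def e_def by (intro continuous_intros cont)+
  note t = test_function_L2[OF \<eta>]
  have split: "(LINT x|unit_measure. A x * (f x * f x) + B x * (f x * h x) + e x * (h x * h x))
      = (LINT x|unit_measure. A x * (f x * f x)) + (LINT x|unit_measure. B x * (f x * h x))
        + (LINT x|unit_measure. e x * (h x * h x))" if "f \<in> L2" "h \<in> L2" for f h
    by (simp only: Bochner_Integration.integral_add Bochner_Integration.integrable_add
        continuous_mult_integrable_unit L2_mult_integrable that cA cB ce)
  have "(\<lambda>n. LINT x|unit_measure. A x * (\<eta> n x * \<eta> n x) + B x * (\<eta> n x * deriv (\<eta> n) x)
        + e x * (deriv (\<eta> n) x * deriv (\<eta> n) x))
      \<longlonglongrightarrow> (LINT x|unit_measure. A x * (v x * v x) + B x * (v x * g x) + e x * (g x * g x))"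
    unfolding split[OF assms(1,2)] split[OF t]
    by (intro tendsto_add LINT_mult_tendsto assms t cA cB ce)
  then have "0 \<le> (LINT x|unit_measure. A x * (v x * v x) + B x * (v x * g x) + e x * (g x * g x))"
  proof (rule LIMSEQ_le_const, intro exI allI impI)
    show "0 \<le> (LINT x|unit_measure. A x * (\<eta> n x * \<eta> n x) + B x * (\<eta> n x * deriv (\<eta> n) x)
        + e x * (deriv (\<eta> n) x * deriv (\<eta> n) x))" for n
      unfolding A_def B_def e_def by (rule second_variation_test_function_nonneg[OF \<eta>])
  qed
  then show ?thesis unfolding A_def B_def e_def .
qed

end

theorem theorem2p9:
  fixes W E l \<kappa> :: real and \<theta> :: "real \<Rightarrow> real"
  assumes "W > 0" and "l \<ge> 1" and "0 < \<kappa>" and "\<kappa> < 1"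
    and "E = 0" and "W\<^sup>2 < 2 / (1 + \<kappa>)"
    and "bvp_solution W E l \<kappa> \<theta>"
    and "\<not> \<theta> constant_on {0..1}"
  shows "\<forall>\<phi>\<in>W12_0. hess W E l \<kappa> \<theta> \<phi> \<ge> 0"
proof
  fix \<phi> assume "\<phi> \<in> W12_0"
  obtain p q where \<theta>: "\<And>x. x \<in> {0..1} \<Longrightarrow> (\<theta> has_real_derivative p x) (at x within {0..1})"
    and p: "\<And>x. x \<in> {0..1} \<Longrightarrow> (p has_real_derivative q x) (at x within {0..1})"
    and contq: "continuous_on {0..1} q"
    and range: "\<And>x. x \<in> {0..1} \<Longrightarrow> \<theta> x \<in> {0..pi}"
    and ode_E: "\<And>x. x \<in> {0<..<1} \<Longrightarrow> elastic \<kappa> (\<theta> x) * q x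
        + 1/2 * (1 - \<kappa>) * sin (2 * \<theta> x) * (p x)\<^sup>2
        + 1/2 * l\<^sup>2 * sin (2 * \<theta> x) - E * l\<^sup>2 * sin (\<theta> x) = 0"
    and bc: "elastic \<kappa> (\<theta> 0) * p 0 = W * l * sin (\<theta> 0)" "elastic \<kappa> (\<theta> 1) * p 1 = W * l * sin (\<theta> 1)"
    by (rule bvp_solution_derivatives[OF assms(7)]) blast
  have ode: "elastic \<kappa> (\<theta> x) * q x + 1/2 * (1 - \<kappa>) * sin (2 * \<theta> x) * (p x)\<^sup>2
      + 1/2 * l\<^sup>2 * sin (2 * \<theta> x) = 0" if "x \<in> {0<..<1}" for x
    using ode_E[OF that] \<open>E = 0\<close> by simp
  have p_pos: "p x > 0" if "x \<in> {0..1}" for x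
    by (rule bvp_solution_strictly_increasing[OF assms(1-4) \<theta> p range ode bc assms(8) that])
  have cont\<theta>: "continuous_on {0..1} \<theta>" using \<theta> by (rule DERIV_continuous_on)
  have contp: "continuous_on {0..1} p" using p by (rule DERIV_continuous_on)
  note \<theta>_L2 = continuous_mem_L2[OF cont\<theta>] and p_L2 = continuous_mem_L2[OF contp]
  obtain v g \<eta> where contv: "continuous_on {0..1} v" and v0: "v 0 = 0" and v1: "v 1 = 0"
    and v_\<phi>: "AE x in unit_measure. v x = \<phi> x" and \<phi>: "\<phi> \<in> L2" and g: "g \<in> L2" "has_weak_deriv \<phi> g"
    and \<eta>: "\<And>n. \<eta> n \<in> test_functions"
    and lim: "(\<lambda>n. LINT x|unit_measure. (v x - \<eta> n x)\<^sup>2) \<longlonglongrightarrow> 0"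
      "(\<lambda>n. LINT x|unit_measure. (g x - deriv (\<eta> n) x)\<^sup>2) \<longlonglongrightarrow> 0"
    by (rule W12_0_representative[OF \<open>\<phi> \<in> W12_0\<close>]) blast
  define c where "c = - W * l * cos (\<theta> 0) + W * l * cos (\<theta> 1)"
  \<comment> \<open>Proved for every s, so that the second derivative at 0 can be computed from the
    right-hand side, which is free of arbitrary choices.\<close>
  have energy: "energy W E l \<kappa> (\<lambda>x. \<theta> x + s * \<phi> x)
      = 1/2 * (LINT x|unit_measure. elastic \<kappa> (\<theta> x + s * v x) * (p x + s * g x)\<^sup>2)
        + 1/2 * l\<^sup>2 * (LINT x|unit_measure. (cos (\<theta> x + s * v x))\<^sup>2) + c" for s
  proof -
    define u where "u = (\<lambda>x. \<theta> x + s * \<phi> x)"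
    have u_L2: "u \<in> L2" unfolding u_def by (rule L2_add[OF \<theta>_L2 \<phi>])
    have P_L2: "(\<lambda>x. p x + s * g x) \<in> L2" by (rule L2_add[OF p_L2 g(1)])
    have u_wd: "has_weak_deriv u (\<lambda>x. p x + s * g x)" unfolding u_def
      by (rule has_weak_deriv_add[OF has_weak_deriv_if_derivative[OF \<theta> contp] g(2) \<theta>_L2 p_L2 \<phi> g(1)])
    note wd = weak_deriv_AE_eq[OF u_wd P_L2]
    have v_u: "AE x in unit_measure. \<theta> x + s * v x = u x"
      using v_\<phi> by eventually_elim (simp add: u_def)
    have cont: "continuous_on {0..1} (\<lambda>x. \<theta> x + s * v x)"
      by (intro continuous_intros cont\<theta> contv)
    have [measurable]: "u \<in> borel_measurable unit_measure" "weak_deriv u \<in> borel_measurable unit_measure"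
      "(\<lambda>x. p x + s * g x) \<in> borel_measurable unit_measure"
      "(\<lambda>x. \<theta> x + s * v x) \<in> borel_measurable unit_measure"
      by (rule L2_measurable[OF u_L2] L2_measurable[OF wd(1)] L2_measurable[OF P_L2]
          borel_measurable_unit[OF cont])+
    have "(LINT x|unit_measure. elastic \<kappa> (u x) * (weak_deriv u x)\<^sup>2)
        = (LINT x|unit_measure. elastic \<kappa> (\<theta> x + s * v x) * (p x + s * g x)\<^sup>2)"
    proof (rule integral_cong_AE)
      show "AE x in unit_measure. elastic \<kappa> (u x) * (weak_deriv u x)\<^sup>2
          = elastic \<kappa> (\<theta> x + s * v x) * (p x + s * g x)\<^sup>2"
        using v_u wd(2) by eventually_elim simp
    qed (unfold elastic_def, measurable)
    moreover have "(LINT x|unit_measure. (cos (u x))\<^sup>2 - 2 * E * cos (u x))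
        = (LINT x|unit_measure. (cos (\<theta> x + s * v x))\<^sup>2)"
    proof (rule integral_cong_AE)
      show "AE x in unit_measure. (cos (u x))\<^sup>2 - 2 * E * cos (u x) = (cos (\<theta> x + s * v x))\<^sup>2"
        using v_u by eventually_elim (simp add: \<open>E = 0\<close>)
    qed measurable
    \<comment> \<open>v vanishes at both ends, so the anchoring terms do not depend on s and drop
      out of the second variation.\<close>
    moreover have "cont_rep u 0 = \<theta> 0" "cont_rep u 1 = \<theta> 1"
      using cont_rep_eq[OF cont v_u, of 0] cont_rep_eq[OF cont v_u, of 1] v0 v1 by simp_all
    ultimately have "energy W E l \<kappa> u
      = 1/2 * (LINT x|unit_measure. elastic \<kappa> (\<theta> x + s * v x) * (p x + s * g x)\<^sup>2)
        + 1/2 * l\<^sup>2 * (LINT x|unit_measure. (cos (\<theta> x + s * v x))\<^sup>2) + c"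
      unfolding energy_def c_def by simp
    then show ?thesis unfolding u_def .
  qed
  show "hess W E l \<kappa> \<theta> \<phi> \<ge> 0"
    unfolding hess_def second_derivative_bulk_energy[OF assms(3,4) cont\<theta> contp contv g(1) energy]
    by (rule second_variation_nonneg[OF assms(3,4) \<theta> p contq ode p_pos continuous_mem_L2[OF contv] g(1) \<eta> lim])
qed

end
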